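(* Let $\mathcal{L}$ be a left bialgebroid over $B$ which admits a faithfully flat left $\mathcal{L}$-Galois extension $N\subseteq P$. Then $\mathcal{L}$ is a left Hopf algebroid. More precisely, for all $X\in\mathcal{L}$, $$X_{+}\otimes X_{-}\otimes 1=X^{<1>}{}_{(-1)}\otimes X^{<2>}{}_{(-1)}\otimes X^{<1>}{}_{(0)}X^{<2>}{}_{(0)}$$ in the quotient of $\mathcal{L}\otimes\mathcal{L}\otimes P$ by the relations $Y\bar a\otimes Z\otimes p=Y\otimes\bar aZ\otimes p$ and $\bar bY\otimes Z\otimes p=Y\otimes Z\otimes bp$ ($a,b\in B$).
   Context: $k$ is a field, $B$ a unital $k$-algebra, $\overline B$ its opposite algebra with canonical anti-isomorphism $B\to\overline B$, $b\mapsto\bar b$, and $B^e=B\otimes\overline B$. $M\diamond_B N:=M\otimes N/\langle \bar bm\otimes n-m\otimes bn\rangle$; $M\times_BN:=\{\sum m_i\otimes n_i\in M\diamond_BN:\ \sum m_i\bar a\otimes n_i=\sum m_i\otimes n_ia\ \forall a\in B\}$. A $B$-ring is an algebra $P$ with an algebra map $B\to P$. A left bialgebroid over $B$ is an algebra $\mathcal{L}$ with algebra maps $s:B\to\mathcal{L}$, $t:\overline B\to\mathcal{L}$ with commuting images (one writes $b,\bar b$ for $s(b),t(\bar b)$), with left $B^e$-module maps $\Delta:\mathcal{L}\to\mathcal{L}\times_B\mathcal{L}$, $\Delta(X)=X_{(1)}\otimes X_{(2)}$ (so $\Delta(b\bar cX)=bX_{(1)}\otimes\bar cX_{(2)}$)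 and $\varepsilon:\mathcal{L}\to B$ (so $\varepsilon(b\bar cX)=b\varepsilon(X)c$), coassociative and counital ($\varepsilon(X_{(1)})X_{(2)}=\overline{\varepsilon(X_{(2)})}X_{(1)}=X$), such that $\Delta$ is an algebra map (componentwise product on $\mathcal{L}\times_B\mathcal{L}$), $\varepsilon(1)=1$ and $\varepsilon(X\varepsilon(Y))=\varepsilon(XY)=\varepsilon(X\overline{\varepsilon(Y)})$. Standing assumption: all $B$-module and $\overline B$-module structures are faithfully flat. $\mathcal{L}$ is a left Hopf algebroid if $\lambda:\mathcal{L}\otimes_{\overline B}\mathcal{L}\to\mathcal{L}\diamond_B\mathcal{L}$, $\lambda(X\otimes Y)=X_{(1)}\otimes X_{(2)}Y$, is bijective; one writes $X_+\otimes_{\overline B}X_-:=\lambda^{-1}(X\diamond1)$. A left $\mathcal{L}$-comodule is a $B$-bimodule $\Gamma$ with a coassociative, counital ($\varepsilon(p_{(-1)})p_{(0)}=p$) map $\Gamma\to\mathcal{L}\times_B\Gamma$, $p\mapsto p_{(-1)}\otimes p_{(0)}$, with $bpb'\mapsto bp_{(-1)}b'\otimes p_{(0)}$. A left $\mathcal{L}$-comodule algebra is a $B$-ring $P$ that is a left $\mathcal{L}$-comodule (with the $B$-bimodule structure of the $B$-ring) whose coaction $P\to\mathcal{L}\times_BP$ is a map of $B$-rings. With $N={}^{co\mathcal{L}}P=\{p: p_{(-1)}\otimes p_{(0)}=1\otimes p\}$, $N\subseteq P$ is a left $\mathcal{L}$-Galois extension if ${}^L\mathrm{can}:P\otimes_NP\to\mathcal{L}\diamond_BP$,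 $p\otimes q\mapsto p_{(-1)}\otimes p_{(0)}q$, is bijective; then $X^{<1>}\otimes_NX^{<2>}:=({}^L\mathrm{can})^{-1}(X\diamond1)$. It is called faithfully flat if $P$ is a faithfully flat left $N$-module. *)

theory Defs
  imports Complex_Main "HOL-Library.Multiset" "HOL-Algebra.Module"
begin

section \<open>Quotients of groups of formal sums\<close>

text \<open>
  A finite formal sum of (pairs or triples representing) pure tensors is a multiset; no
  coefficients are needed because $-(m \otimes n) = (-m) \otimes n$. An element of a tensor
  product is a class of formal sums modulo the congruence generated by a set of defining
  relations. The relations used below contain \<open>0 \<otimes> n = 0\<close> explicitly, since a commutative
  monoid has no cancellation; given these, the quotient is the usual abelian group.
\<close>

inductive tcong :: "('a multiset \<times> 'a multiset) set \<Rightarrow> 'a multiset \<Rightarrow> 'a multiset \<Rightarrow> bool"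
  for \<rho> where
  base: "(x, y) \<in> \<rho> \<Longrightarrow> tcong \<rho> x y"
| refl: "tcong \<rho> x x"
| sym: "tcong \<rho> x y \<Longrightarrow> tcong \<rho> y x"
| trans: "tcong \<rho> x y \<Longrightarrow> tcong \<rho> y z \<Longrightarrow> tcong \<rho> x z"
| add: "tcong \<rho> x y \<Longrightarrow> tcong \<rho> x' y' \<Longrightarrow> tcong \<rho> (x + x') (y + y')"

definition tclass :: "('a multiset \<times> 'a multiset) set \<Rightarrow> 'a multiset \<Rightarrow> 'a multiset set" where
  "tclass \<rho> x = {y. tcong \<rho> x y}"

definition quot :: "('a multiset \<times> 'a multiset) set \<Rightarrow> 'a multiset set set" where
  "quot \<rho> = range (tclass \<rho>)"

text \<open>
  A representing formal sum of a class. It is used for Sweedler notation: every expression below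
  that mentions \<open>rep C\<close> is, under the hypotheses in force, independent of the representative.
\<close>

definition rep :: "'a multiset set \<Rightarrow> 'a multiset" where
  "rep C = (SOME z. z \<in> C)"

section \<open>Modules, tensor products and faithful flatness\<close>

text \<open>
  The module records of HOL-Algebra are used for one-sided modules over a possibly
  non-commutative ring. For a right module, \<open>r \<odot> x\<close> denotes $x \cdot r$. The fields \<open>mult\<close> and
  \<open>one\<close> of the record play no role.
\<close>

locale left_module = R?: ring R + M?: abelian_group M
  for R :: "'r ring" and M :: "('r, 'm) module" +
  assumes smult_closed: "\<lbrakk>r \<in> carrier R; x \<in> carrier M\<rbrakk> \<Longrightarrow> r \<odot>\<^bsub>M\<^esub> x \<in> carrier M"
    and smult_l_distr: "\<lbrakk>r \<in> carrier R; r' \<in> carrier R; x \<in> carrier M\<rbrakk> \<Longrightarrow>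
      (r \<oplus>\<^bsub>R\<^esub> r') \<odot>\<^bsub>M\<^esub> x = (r \<odot>\<^bsub>M\<^esub> x) \<oplus>\<^bsub>M\<^esub> (r' \<odot>\<^bsub>M\<^esub> x)"
    and smult_r_distr: "\<lbrakk>r \<in> carrier R; x \<in> carrier M; y \<in> carrier M\<rbrakk> \<Longrightarrow>
      r \<odot>\<^bsub>M\<^esub> (x \<oplus>\<^bsub>M\<^esub> y) = (r \<odot>\<^bsub>M\<^esub> x) \<oplus>\<^bsub>M\<^esub> (r \<odot>\<^bsub>M\<^esub> y)"
    and smult_assoc: "\<lbrakk>r \<in> carrier R; r' \<in> carrier R; x \<in> carrier M\<rbrakk> \<Longrightarrow>
      (r \<otimes>\<^bsub>R\<^esub> r') \<odot>\<^bsub>M\<^esub> x = r \<odot>\<^bsub>M\<^esub> (r' \<odot>\<^bsub>M\<^esub> x)"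
    and smult_one: "x \<in> carrier M \<Longrightarrow> \<one>\<^bsub>R\<^esub> \<odot>\<^bsub>M\<^esub> x = x"

locale right_module = R?: ring R + M?: abelian_group M
  for R :: "'r ring" and M :: "('r, 'm) module" +
  assumes smult_closed: "\<lbrakk>r \<in> carrier R; x \<in> carrier M\<rbrakk> \<Longrightarrow> r \<odot>\<^bsub>M\<^esub> x \<in> carrier M"
    and smult_l_distr: "\<lbrakk>r \<in> carrier R; r' \<in> carrier R; x \<in> carrier M\<rbrakk> \<Longrightarrow>
      (r \<oplus>\<^bsub>R\<^esub> r') \<odot>\<^bsub>M\<^esub> x = (r \<odot>\<^bsub>M\<^esub> x) \<oplus>\<^bsub>M\<^esub> (r' \<odot>\<^bsub>M\<^esub> x)"
    and smult_r_distr: "\<lbrakk>r \<in> carrier R; x \<in> carrier M; y \<in> carrier M\<rbrakk> \<Longrightarrow>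
      r \<odot>\<^bsub>M\<^esub> (x \<oplus>\<^bsub>M\<^esub> y) = (r \<odot>\<^bsub>M\<^esub> x) \<oplus>\<^bsub>M\<^esub> (r \<odot>\<^bsub>M\<^esub> y)"
    and smult_assoc: "\<lbrakk>r \<in> carrier R; r' \<in> carrier R; x \<in> carrier M\<rbrakk> \<Longrightarrow>
      (r \<otimes>\<^bsub>R\<^esub> r') \<odot>\<^bsub>M\<^esub> x = r' \<odot>\<^bsub>M\<^esub> (r \<odot>\<^bsub>M\<^esub> x)"
    and smult_one: "x \<in> carrier M \<Longrightarrow> \<one>\<^bsub>R\<^esub> \<odot>\<^bsub>M\<^esub> x = x"

definition module_maps :: "'r ring \<Rightarrow> ('r, 'm) module \<Rightarrow> ('r, 'n) module \<Rightarrow> ('m \<Rightarrow> 'n) set" where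
  "module_maps R X Y = {f. f \<in> carrier X \<rightarrow> carrier Y \<and>
     (\<forall>x\<in>carrier X. \<forall>y\<in>carrier X. f (x \<oplus>\<^bsub>X\<^esub> y) = f x \<oplus>\<^bsub>Y\<^esub> f y) \<and>
     (\<forall>r\<in>carrier R. \<forall>x\<in>carrier X. f (r \<odot>\<^bsub>X\<^esub> x) = r \<odot>\<^bsub>Y\<^esub> f x)}"

text \<open>
  The defining relations of the tensor product of \<open>X\<close> (scalars acting from the right) and \<open>M\<close>
  (scalars acting from the left), balanced over the set \<open>S\<close> of scalars.
\<close>

inductive_set tensor_rel ::
    "'r set \<Rightarrow> ('r, 'm) module \<Rightarrow> ('r, 'n) module \<Rightarrow> (('m \<times> 'n) multiset \<times> ('m \<times> 'n) multiset) set"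
  for S X M where
  add_left: "\<lbrakk>x \<in> carrier X; x' \<in> carrier X; m \<in> carrier M\<rbrakk> \<Longrightarrow>
    ({#(x \<oplus>\<^bsub>X\<^esub> x', m)#}, {#(x, m), (x', m)#}) \<in> tensor_rel S X M"
| add_right: "\<lbrakk>x \<in> carrier X; m \<in> carrier M; m' \<in> carrier M\<rbrakk> \<Longrightarrow>
    ({#(x, m \<oplus>\<^bsub>M\<^esub> m')#}, {#(x, m), (x, m')#}) \<in> tensor_rel S X M"
| zero_left: "m \<in> carrier M \<Longrightarrow> ({#(\<zero>\<^bsub>X\<^esub>, m)#}, {#}) \<in> tensor_rel S X M"
| zero_right: "x \<in> carrier X \<Longrightarrow> ({#(x, \<zero>\<^bsub>M\<^esub>)#}, {#}) \<in> tensor_rel S X M"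
| balanced: "\<lbrakk>r \<in> S; x \<in> carrier X; m \<in> carrier M\<rbrakk> \<Longrightarrow>
    ({#(r \<odot>\<^bsub>X\<^esub> x, m)#}, {#(x, r \<odot>\<^bsub>M\<^esub> m)#}) \<in> tensor_rel S X M"

definition tensor :: "'r ring \<Rightarrow> ('r, 'm) module \<Rightarrow> ('r, 'n) module \<Rightarrow> ('m \<times> 'n) multiset set set" where
  "tensor R X M =
     tclass (tensor_rel (carrier R) X M) ` {z. set_mset z \<subseteq> carrier X \<times> carrier M}"

text \<open>The map $f \otimes \mathrm{id}_M$ into the tensor product of \<open>Y\<close> and \<open>M\<close>.\<close>

definition tensor_map :: "'r ring \<Rightarrow> ('r, 'y) module \<Rightarrow> ('r, 'm) module \<Rightarrow> ('x \<Rightarrow> 'y)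
    \<Rightarrow> ('x \<times> 'm) multiset set \<Rightarrow> ('y \<times> 'm) multiset set" where
  "tensor_map R Y M f C =
     tclass (tensor_rel (carrier R) Y M) (image_mset (\<lambda>(x, m). (f x, m)) (rep C))"

text \<open>
  \<open>M\<close> is faithfully flat if a sequence $X \to Y \to Z$ of right modules is exact if and only if
  the tensored sequence is. HOL cannot quantify over modules on all types, so the test modules
  live on subsets of one type \<open>'u\<close>. Testing on right ideals and on cyclic modules already
  characterises faithful flatness, so this is the usual notion as soon as the cardinality of \<open>'u\<close>
  is at least that of the carrier of \<open>R\<close>.
\<close>

definition faithfully_flat :: "'u itself \<Rightarrow> 'r ring \<Rightarrow> ('r, 'm) module \<Rightarrow> bool" where
  "faithfully_flat U R M \<longleftrightarrow> left_module R M \<and>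
     (\<forall>(X :: ('r, 'u) module) (Y :: ('r, 'u) module) (Z :: ('r, 'u) module) f g.
        right_module R X \<and> right_module R Y \<and> right_module R Z \<and>
        f \<in> module_maps R X Y \<and> g \<in> module_maps R Y Z \<longrightarrow>
        (f ` carrier X = {y \<in> carrier Y. g y = \<zero>\<^bsub>Z\<^esub>} \<longleftrightarrow>
         tensor_map R Y M f ` tensor R X M =
           {C \<in> tensor R Y M. tensor_map R Z M g C = tclass (tensor_rel (carrier R) Z M) {#}}))"

section \<open>Algebras over a field\<close>

text \<open>
  Rings with unit are types of sort \<open>{ring, monoid_mult}\<close>; unlike \<open>ring_1\<close> this admits the zero
  ring.
\<close>

locale k_algebra = vector_space scale
  for scale :: "'k::field \<Rightarrow> 'a::{ring,monoid_mult} \<Rightarrow> 'a" +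
  assumes scale_mult_left: "scale c x * y = scale c (x * y)"
    and scale_mult_right: "x * scale c y = scale c (x * y)"

definition algebra_map :: "('k::field \<Rightarrow> 'a::{ring,monoid_mult} \<Rightarrow> 'a)
    \<Rightarrow> ('k \<Rightarrow> 'c::{ring,monoid_mult} \<Rightarrow> 'c) \<Rightarrow> ('a \<Rightarrow> 'c) \<Rightarrow> bool" where
  "algebra_map sA sC f \<longleftrightarrow>
     Vector_Spaces.linear sA sC f \<and> f 1 = 1 \<and> (\<forall>x y. f (x * y) = f x * f y)"

text \<open>An algebra map out of the opposite algebra of \<open>'a\<close>.\<close>

definition op_algebra_map :: "('k::field \<Rightarrow> 'a::{ring,monoid_mult} \<Rightarrow> 'a)
    \<Rightarrow> ('k \<Rightarrow> 'c::{ring,monoid_mult} \<Rightarrow> 'c) \<Rightarrow> ('a \<Rightarrow> 'c) \<Rightarrow> bool" where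
  "op_algebra_map sA sC f \<longleftrightarrow>
     Vector_Spaces.linear sA sC f \<and> f 1 = 1 \<and> (\<forall>x y. f (x * y) = f y * f x)"

definition ring_of :: "'a::{ring,monoid_mult} set \<Rightarrow> 'a ring" where
  "ring_of S = \<lparr>carrier = S, mult = (*), one = 1, zero = 0, add = (+)\<rparr>"

definition op_ring_of :: "'a::{ring,monoid_mult} set \<Rightarrow> 'a ring" where
  "op_ring_of S = \<lparr>carrier = S, mult = (\<lambda>a b. b * a), one = 1, zero = 0, add = (+)\<rparr>"

definition univ_module :: "('r \<Rightarrow> 'm \<Rightarrow> 'm) \<Rightarrow> ('r, 'm::ab_group_add) module" where
  "univ_module act =
     \<lparr>carrier = UNIV, mult = undefined, one = undefined, zero = 0, add = (+), smult = act\<rparr>"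

section \<open>The products \<open>\<diamondop>\<close> and \<open>\<times>\<close> over \<open>B\<close>\<close>

text \<open>
  $M \diamond_B N$ as a quotient of the tensor product over the ground field: \<open>tM b m\<close> is
  $\bar b m$ and \<open>sN b n\<close> is $b n$.
\<close>

inductive_set diamond_rel :: "('k \<Rightarrow> 'm::ab_group_add \<Rightarrow> 'm) \<Rightarrow> ('k \<Rightarrow> 'n::ab_group_add \<Rightarrow> 'n)
    \<Rightarrow> ('b \<Rightarrow> 'm \<Rightarrow> 'm) \<Rightarrow> ('b \<Rightarrow> 'n \<Rightarrow> 'n) \<Rightarrow> (('m \<times> 'n) multiset \<times> ('m \<times> 'n) multiset) set"
  for kM kN tM sN where
  ground: "r \<in> tensor_rel UNIV (univ_module kM) (univ_module kN) \<Longrightarrow> r \<in> diamond_rel kM kN tM sN"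
| balanced: "({#(tM b m, n)#}, {#(m, sN b n)#}) \<in> diamond_rel kM kN tM sN"

text \<open>
  $M \times_B N$ inside the quotient by \<open>\<rho>\<close>; \<open>rM a m\<close> is $m \bar a$ and \<open>rN a n\<close> is $n a$.
\<close>

definition takeuchi :: "(('m \<times> 'n) multiset \<times> ('m \<times> 'n) multiset) set
    \<Rightarrow> ('b \<Rightarrow> 'm \<Rightarrow> 'm) \<Rightarrow> ('b \<Rightarrow> 'n \<Rightarrow> 'n) \<Rightarrow> ('m \<times> 'n) multiset set set" where
  "takeuchi \<rho> rM rN = {tclass \<rho> z | z.
     \<forall>a. tclass \<rho> (image_mset (\<lambda>(m, n). (rM a m, n)) z) =
         tclass \<rho> (image_mset (\<lambda>(m, n). (m, rN a n)) z)}"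

text \<open>Threefold tensor products over the ground field.\<close>

inductive_set tensor3_rel :: "('k \<Rightarrow> 'm::ab_group_add \<Rightarrow> 'm) \<Rightarrow> ('k \<Rightarrow> 'n::ab_group_add \<Rightarrow> 'n)
    \<Rightarrow> ('k \<Rightarrow> 'q::ab_group_add \<Rightarrow> 'q)
    \<Rightarrow> (('m \<times> 'n \<times> 'q) multiset \<times> ('m \<times> 'n \<times> 'q) multiset) set"
  for kM kN kQ where
  add1: "({#(m + m', n, q)#}, {#(m, n, q), (m', n, q)#}) \<in> tensor3_rel kM kN kQ"
| add2: "({#(m, n + n', q)#}, {#(m, n, q), (m, n', q)#}) \<in> tensor3_rel kM kN kQ"
| add3: "({#(m, n, q + q')#}, {#(m, n, q), (m, n, q')#}) \<in> tensor3_rel kM kN kQ"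
| zero1: "({#(0, n, q)#}, {#}) \<in> tensor3_rel kM kN kQ"
| zero2: "({#(m, 0, q)#}, {#}) \<in> tensor3_rel kM kN kQ"
| zero3: "({#(m, n, 0)#}, {#}) \<in> tensor3_rel kM kN kQ"
| scale12: "({#(kM c m, n, q)#}, {#(m, kN c n, q)#}) \<in> tensor3_rel kM kN kQ"
| scale23: "({#(m, kN c n, q)#}, {#(m, n, kQ c q)#}) \<in> tensor3_rel kM kN kQ"

section \<open>Left bialgebroids\<close>

text \<open>\<open>tgt H b\<close> is the image of $\bar b$ under the target map.\<close>

record ('k, 'b, 'l) bialgebroid =
  base_scale :: "'k \<Rightarrow> 'b \<Rightarrow> 'b"
  total_scale :: "'k \<Rightarrow> 'l \<Rightarrow> 'l"
  src :: "'b \<Rightarrow> 'l"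
  tgt :: "'b \<Rightarrow> 'l"
  comul :: "'l \<Rightarrow> ('l \<times> 'l) multiset set"
  counit :: "'l \<Rightarrow> 'b"

text \<open>
  $\mathcal{L} \diamond_B N$ and $\mathcal{L} \diamond_B \mathcal{L} \diamond_B N$ for a module \<open>N\<close>
  with scalar multiplication \<open>kN\<close> and left \<open>B\<close>-action \<open>sN\<close>.
\<close>

definition ldiamond_rel :: "('k, 'b, 'l::{ring,monoid_mult}) bialgebroid
    \<Rightarrow> ('k \<Rightarrow> 'n::ab_group_add \<Rightarrow> 'n) \<Rightarrow> ('b \<Rightarrow> 'n \<Rightarrow> 'n)
    \<Rightarrow> (('l \<times> 'n) multiset \<times> ('l \<times> 'n) multiset) set" where
  "ldiamond_rel H kN sN = diamond_rel (total_scale H) kN (\<lambda>b X. tgt H b * X) sN"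

inductive_set ldiamond3_rel :: "('k, 'b, 'l::{ring,monoid_mult}) bialgebroid
    \<Rightarrow> ('k \<Rightarrow> 'n::ab_group_add \<Rightarrow> 'n) \<Rightarrow> ('b \<Rightarrow> 'n \<Rightarrow> 'n)
    \<Rightarrow> (('l \<times> 'l \<times> 'n) multiset \<times> ('l \<times> 'l \<times> 'n) multiset) set"
  for H kN sN where
  ground: "r \<in> tensor3_rel (total_scale H) (total_scale H) kN \<Longrightarrow> r \<in> ldiamond3_rel H kN sN"
| balanced12: "({#(tgt H b * X, Y, n)#}, {#(X, src H b * Y, n)#}) \<in> ldiamond3_rel H kN sN"
| balanced23: "({#(X, tgt H b * Y, n)#}, {#(X, Y, sN b n)#}) \<in> ldiamond3_rel H kN sN"

definition LL_rel :: "('k, 'b, 'l::{ring,monoid_mult}) bialgebroid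
    \<Rightarrow> (('l \<times> 'l) multiset \<times> ('l \<times> 'l) multiset) set" where
  "LL_rel H = ldiamond_rel H (total_scale H) (\<lambda>b X. src H b * X)"

text \<open>The formal sum of all $(x x', y y')$, for products in $\mathcal{L} \times_B N$.\<close>

definition mult_sum :: "('a::times \<times> 'c::times) multiset \<Rightarrow> ('a \<times> 'c) multiset \<Rightarrow> ('a \<times> 'c) multiset" where
  "mult_sum z w = (\<Sum>(x, y)\<in>#z. image_mset (\<lambda>(x', y'). (x * x', y * y')) w)"

locale left_bialgebroid =
  base: k_algebra "base_scale H" + total: k_algebra "total_scale H"
  for H :: "('k::field, 'b::{ring,monoid_mult}, 'l::{ring,monoid_mult}) bialgebroid" +
  assumes src_hom: "algebra_map (base_scale H) (total_scale H) (src H)"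
    and tgt_hom: "op_algebra_map (base_scale H) (total_scale H) (tgt H)"
    and src_tgt_commute: "src H b * tgt H c = tgt H c * src H b"
    and comul_takeuchi:
      "comul H X \<in> takeuchi (LL_rel H) (\<lambda>a Y. Y * tgt H a) (\<lambda>a Y. Y * src H a)"
    and comul_add: "comul H (X + Y) = tclass (LL_rel H) (rep (comul H X) + rep (comul H Y))"
    and comul_bimodule: "comul H (src H b * tgt H c * X) =
      tclass (LL_rel H) (image_mset (\<lambda>(x, y). (src H b * x, tgt H c * y)) (rep (comul H X)))"
    and counit_add: "counit H (X + Y) = counit H X + counit H Y"
    and counit_bimodule: "counit H (src H b * tgt H c * X) = b * counit H X * c"
    and coassociative:
      "tclass (ldiamond3_rel H (total_scale H) (\<lambda>b X. src H b * X))
         (\<Sum>(x, y)\<in>#rep (comul H X). image_mset (\<lambda>(u, v). (u, v, y)) (rep (comul H x))) =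
       tclass (ldiamond3_rel H (total_scale H) (\<lambda>b X. src H b * X))
         (\<Sum>(x, y)\<in>#rep (comul H X). image_mset (\<lambda>(u, v). (x, u, v)) (rep (comul H y)))"
    and counital_left: "(\<Sum>(x, y)\<in>#rep (comul H X). src H (counit H x) * y) = X"
    and counital_right: "(\<Sum>(x, y)\<in>#rep (comul H X). tgt H (counit H y) * x) = X"
    and comul_mult:
      "comul H (X * Y) = tclass (LL_rel H) (mult_sum (rep (comul H X)) (rep (comul H Y)))"
    and comul_one: "comul H 1 = tclass (LL_rel H) {#(1, 1)#}"
    and counit_one: "counit H 1 = 1"
    and counit_mult_src: "counit H (X * src H (counit H Y)) = counit H (X * Y)"
    and counit_mult_tgt: "counit H (X * tgt H (counit H Y)) = counit H (X * Y)"

text \<open>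
  Faithful flatness of $\mathcal{L}$ for its left and right \<open>B\<close>-module structures and then for its
  left and right $\overline{B}$-module structures; right modules are left modules over the opposite
  ring, and the opposite of $\overline{B}$ is \<open>B\<close>.
\<close>

definition total_faithfully_flat :: "'u itself
    \<Rightarrow> ('k, 'b::{ring,monoid_mult}, 'l::{ring,monoid_mult}) bialgebroid \<Rightarrow> bool" where
  "total_faithfully_flat U H \<longleftrightarrow>
     faithfully_flat U (ring_of UNIV) (univ_module (\<lambda>b X. src H b * X)) \<and>
     faithfully_flat U (op_ring_of UNIV) (univ_module (\<lambda>b X. X * src H b)) \<and>
     faithfully_flat U (op_ring_of UNIV) (univ_module (\<lambda>b X. tgt H b * X)) \<and>
     faithfully_flat U (ring_of UNIV) (univ_module (\<lambda>b X. X * tgt H b))"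

section \<open>Left Hopf algebroids\<close>

text \<open>$\mathcal{L} \otimes_{\overline{B}} \mathcal{L}$, with $X \bar a \otimes Y = X \otimes \bar a Y$.\<close>

definition LbarL_rel :: "('k, 'b, 'l::{ring,monoid_mult}) bialgebroid
    \<Rightarrow> (('l \<times> 'l) multiset \<times> ('l \<times> 'l) multiset) set" where
  "LbarL_rel H =
     tensor_rel UNIV (univ_module (\<lambda>a X. X * tgt H a)) (univ_module (\<lambda>a X. tgt H a * X))"

definition hopf_map :: "('k, 'b, 'l::{ring,monoid_mult}) bialgebroid
    \<Rightarrow> ('l \<times> 'l) multiset set \<Rightarrow> ('l \<times> 'l) multiset set" where
  "hopf_map H C = tclass (LL_rel H)
     (\<Sum>(X, Y)\<in>#rep C. image_mset (\<lambda>(x, x'). (x, x' * Y)) (rep (comul H X)))"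

definition left_hopf_algebroid ::
    "('k::field, 'b::{ring,monoid_mult}, 'l::{ring,monoid_mult}) bialgebroid \<Rightarrow> bool" where
  "left_hopf_algebroid H \<longleftrightarrow>
     left_bialgebroid H \<and> bij_betw (hopf_map H) (quot (LbarL_rel H)) (quot (LL_rel H))"

text \<open>$X_+ \otimes_{\overline{B}} X_-$\<close>

definition plus_minus :: "('k, 'b, 'l::{ring,monoid_mult}) bialgebroid
    \<Rightarrow> 'l \<Rightarrow> ('l \<times> 'l) multiset set" where
  "plus_minus H X = inv_into (quot (LbarL_rel H)) (hopf_map H) (tclass (LL_rel H) {#(X, 1)#})"

section \<open>Comodules and comodule algebras\<close>

locale k_bimodule = B: k_algebra kB + vector_space kG
  for kB :: "'k::field \<Rightarrow> 'b::{ring,monoid_mult} \<Rightarrow> 'b"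
    and kG :: "'k \<Rightarrow> 'g::ab_group_add \<Rightarrow> 'g" +
  fixes lact ract :: "'b \<Rightarrow> 'g \<Rightarrow> 'g"
  assumes lact_add: "lact b (p + q) = lact b p + lact b q"
    and add_lact: "lact (b + c) p = lact b p + lact c p"
    and lact_lact: "lact (b * c) p = lact b (lact c p)"
    and lact_one: "lact 1 p = p"
    and ract_add: "ract b (p + q) = ract b p + ract b q"
    and add_ract: "ract (b + c) p = ract b p + ract c p"
    and ract_ract: "ract (b * c) p = ract c (ract b p)"
    and ract_one: "ract 1 p = p"
    and lact_ract: "lact b (ract c p) = ract c (lact b p)"
    and lact_scale: "lact (kB r 1) p = kG r p"
    and ract_scale: "ract (kB r 1) p = kG r p"

locale left_comodule = left_bialgebroid H + k_bimodule "base_scale H" kG lact ract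
  for H :: "('k::field, 'b::{ring,monoid_mult}, 'l::{ring,monoid_mult}) bialgebroid"
    and kG :: "'k \<Rightarrow> 'g::ab_group_add \<Rightarrow> 'g" and lact ract :: "'b \<Rightarrow> 'g \<Rightarrow> 'g" +
  fixes coact :: "'g \<Rightarrow> ('l \<times> 'g) multiset set"
  assumes coact_takeuchi:
      "coact p \<in> takeuchi (ldiamond_rel H kG lact) (\<lambda>a X. X * tgt H a) ract"
    and coact_add:
      "coact (p + q) = tclass (ldiamond_rel H kG lact) (rep (coact p) + rep (coact q))"
    and coact_bimodule: "coact (lact b (ract b' p)) =
      tclass (ldiamond_rel H kG lact)
        (image_mset (\<lambda>(x, p'). (src H b * x * src H b', p')) (rep (coact p)))"
    and coact_coassociative:
      "tclass (ldiamond3_rel H kG lact)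
         (\<Sum>(x, p')\<in>#rep (coact p). image_mset (\<lambda>(u, v). (u, v, p')) (rep (comul H x))) =
       tclass (ldiamond3_rel H kG lact)
         (\<Sum>(x, p')\<in>#rep (coact p). image_mset (\<lambda>(u, v). (x, u, v)) (rep (coact p')))"
    and coact_counital: "(\<Sum>(x, p')\<in>#rep (coact p). lact (counit H x) p') = p"

text \<open>
  A \<open>B\<close>-ring, with structure map \<open>str\<close>, together with a coaction.
\<close>

record ('k, 'b, 'l, 'p) coacted_ring =
  ring_scale :: "'k \<Rightarrow> 'p \<Rightarrow> 'p"
  str :: "'b \<Rightarrow> 'p"
  coaction :: "'p \<Rightarrow> ('l \<times> 'p) multiset set"

text \<open>$\mathcal{L} \diamond_B P$\<close>

definition LP_rel :: "('k, 'b, 'l::{ring,monoid_mult}) bialgebroid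
    \<Rightarrow> ('k, 'b, 'l, 'p::{ring,monoid_mult}) coacted_ring
    \<Rightarrow> (('l \<times> 'p) multiset \<times> ('l \<times> 'p) multiset) set" where
  "LP_rel H A = ldiamond_rel H (ring_scale A) (\<lambda>b p. str A b * p)"

text \<open>
  That the coaction is a map of \<open>B\<close>-rings, that is \<open>coaction (str b) = b \<otimes> 1\<close>, is part of
  \<open>comodule\<close> and \<open>coaction_one\<close>.
\<close>

locale left_comodule_algebra = left_bialgebroid H + P: k_algebra "ring_scale A"
  for H :: "('k::field, 'b::{ring,monoid_mult}, 'l::{ring,monoid_mult}) bialgebroid"
    and A :: "('k, 'b, 'l, 'p::{ring,monoid_mult}) coacted_ring" +
  assumes str_hom: "algebra_map (base_scale H) (ring_scale A) (str A)"
    and comodule: "left_comodule H (ring_scale A) (\<lambda>b p. str A b * p) (\<lambda>b p. p * str A b) (coaction A)"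
    and coaction_mult: "coaction A (p * q) =
      tclass (LP_rel H A) (mult_sum (rep (coaction A p)) (rep (coaction A q)))"
    and coaction_one: "coaction A 1 = tclass (LP_rel H A) {#(1, 1)#}"

definition ring_faithfully_flat :: "'u itself
    \<Rightarrow> ('k, 'b::{ring,monoid_mult}, 'l, 'p::{ring,monoid_mult}) coacted_ring \<Rightarrow> bool" where
  "ring_faithfully_flat U A \<longleftrightarrow>
     faithfully_flat U (ring_of UNIV) (univ_module (\<lambda>b p. str A b * p)) \<and>
     faithfully_flat U (op_ring_of UNIV) (univ_module (\<lambda>b p. p * str A b))"

section \<open>Left Galois extensions\<close>

definition coinvariants :: "('k, 'b, 'l::{ring,monoid_mult}) bialgebroid
    \<Rightarrow> ('k, 'b, 'l, 'p::{ring,monoid_mult}) coacted_ring \<Rightarrow> 'p set" where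
  "coinvariants H A = {p. coaction A p = tclass (LP_rel H A) {#(1, p)#}}"

text \<open>$P \otimes_N P$ for the subring \<open>N\<close> of coinvariants\<close>

definition PNP_rel :: "('k, 'b, 'l::{ring,monoid_mult}) bialgebroid
    \<Rightarrow> ('k, 'b, 'l, 'p::{ring,monoid_mult}) coacted_ring
    \<Rightarrow> (('p \<times> 'p) multiset \<times> ('p \<times> 'p) multiset) set" where
  "PNP_rel H A =
     tensor_rel (coinvariants H A) (univ_module (\<lambda>n p. p * n)) (univ_module (\<lambda>n p. n * p))"

definition can :: "('k, 'b, 'l::{ring,monoid_mult}) bialgebroid
    \<Rightarrow> ('k, 'b, 'l, 'p::{ring,monoid_mult}) coacted_ring
    \<Rightarrow> ('p \<times> 'p) multiset set \<Rightarrow> ('l \<times> 'p) multiset set" where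
  "can H A C = tclass (LP_rel H A)
     (\<Sum>(p, q)\<in>#rep C. image_mset (\<lambda>(x, p'). (x, p' * q)) (rep (coaction A p)))"

definition left_galois :: "('k::field, 'b::{ring,monoid_mult}, 'l::{ring,monoid_mult}) bialgebroid
    \<Rightarrow> ('k, 'b, 'l, 'p::{ring,monoid_mult}) coacted_ring \<Rightarrow> bool" where
  "left_galois H A \<longleftrightarrow>
     left_comodule_algebra H A \<and> bij_betw (can H A) (quot (PNP_rel H A)) (quot (LP_rel H A))"

definition faithfully_flat_galois :: "'u itself
    \<Rightarrow> ('k::field, 'b::{ring,monoid_mult}, 'l::{ring,monoid_mult}) bialgebroid
    \<Rightarrow> ('k, 'b, 'l, 'p::{ring,monoid_mult}) coacted_ring \<Rightarrow> bool" where
  "faithfully_flat_galois U H A \<longleftrightarrow> left_galois H A \<and>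
     faithfully_flat U (ring_of (coinvariants H A)) (univ_module (\<lambda>n p. n * p))"

text \<open>$X^{\langle 1\rangle} \otimes_N X^{\langle 2\rangle}$\<close>

definition translation :: "('k, 'b, 'l::{ring,monoid_mult}) bialgebroid
    \<Rightarrow> ('k, 'b, 'l, 'p::{ring,monoid_mult}) coacted_ring \<Rightarrow> 'l \<Rightarrow> ('p \<times> 'p) multiset set" where
  "translation H A X = inv_into (quot (PNP_rel H A)) (can H A) (tclass (LP_rel H A) {#(X, 1)#})"

text \<open>
  The relations $Y \bar a \otimes Z \otimes p = Y \otimes \bar a Z \otimes p$ and
  $\bar b Y \otimes Z \otimes p = Y \otimes Z \otimes b p$ on
  $\mathcal{L} \otimes \mathcal{L} \otimes P$.
\<close>

inductive_set LLP_rel :: "('k, 'b, 'l::{ring,monoid_mult}) bialgebroid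
    \<Rightarrow> ('k, 'b, 'l, 'p::{ring,monoid_mult}) coacted_ring
    \<Rightarrow> (('l \<times> 'l \<times> 'p) multiset \<times> ('l \<times> 'l \<times> 'p) multiset) set"
  for H A where
  ground: "r \<in> tensor3_rel (total_scale H) (total_scale H) (ring_scale A) \<Longrightarrow> r \<in> LLP_rel H A"
| balanced12: "({#(Y * tgt H a, Z, p)#}, {#(Y, tgt H a * Z, p)#}) \<in> LLP_rel H A"
| balanced13: "({#(tgt H b * Y, Z, p)#}, {#(Y, Z, str A b * p)#}) \<in> LLP_rel H A"

text \<open>
  The carrier type of test modules for faithful flatness. It has at least the cardinality of
  \<open>B\<close> and of every subring of \<open>P\<close>, and it contains copies of all iterated tensor products of
  \<open>B\<close>, $\mathcal{L}$ and \<open>P\<close>.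
\<close>

type_synonym ('b, 'l, 'p) test_universe = "('b + 'l + 'p) list set"

end

theory Submission
  imports Defs
begin

text \<open>
  Write the Hopf map as \<open>\<lambda>(X \<otimes> Y) = X\<^sub>1 \<otimes> X\<^sub>2 Y\<close>, the coaction as \<open>p \<mapsto> p\<^sub>-\<^sub>1 \<otimes> p\<^sub>0\<close> and
  the translation map as \<open>X \<mapsto> X' \<otimes> X''\<close>, so that \<open>X'\<^sub>-\<^sub>1 \<otimes> X'\<^sub>0 X'' = X \<otimes> 1\<close>. The idea is that
  \<open>\<lambda>\<close> becomes invertible after tensoring with \<open>P\<close> over \<open>B\<close>, because there, up to isomorphisms given
  by the Galois map, it is a composite of Galois maps; as \<open>P\<close> is faithfully flat over \<open>B\<close>, it was invertible before.

  In detail, let \<open>\<Lambda>(X \<otimes> Y \<otimes> r) = X\<^sub>1 \<otimes> X\<^sub>2 Y \<otimes> r\<close> (\<open>hopf_triple\<close>). Coassociativity of the coaction and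
  multiplicativity give
  \<open>\<Lambda>(p\<^sub>-\<^sub>1 \<otimes> q\<^sub>-\<^sub>1 \<otimes> p\<^sub>0 q\<^sub>0) = p\<^sub>-\<^sub>1 \<otimes> (p\<^sub>0 q)\<^sub>-\<^sub>1 \<otimes> (p\<^sub>0 q)\<^sub>0\<close>
  (\<open>hopf_double_coact\<close>): the right-hand side is the image of \<open>p \<otimes> q\<close> under the Galois map followed by the
  coaction of the second factor, and \<open>\<Lambda>\<close> commutes with right multiplication in the last factor. Reading this backwards suggests the inverse
  \<open>X \<otimes> Y \<otimes> r \<mapsto> X'\<^sub>-\<^sub>1 \<otimes> X''\<^sub>-\<^sub>1 Y \<otimes> X'\<^sub>0 X''\<^sub>0 r\<close> (\<open>hopf_triple_inv\<close>). It is a right inverse by the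
  displayed identity with \<open>p \<otimes> q = X' \<otimes> X''\<close> (\<open>hopf_triple_surj\<close>). It is a left inverse because the
  elements \<open>p\<^sub>-\<^sub>1 \<otimes> q\<^sub>-\<^sub>1 \<otimes> p\<^sub>0 q\<^sub>0 r\<close> generate the source of \<open>\<Lambda>\<close> (\<open>triple_generated\<close>) and on them the
  identity can be checked (\<open>hopf_triple_inv_double_coact\<close>). Faithful flatness is applied to the
  sequences \<open>0 \<rightarrow> \<L> \<otimes> \<L> \<rightarrow> \<L> \<diamondop> \<L>\<close> and \<open>\<L> \<otimes> \<L> \<rightarrow> \<L> \<diamondop> \<L> \<rightarrow> 0\<close> (\<open>hopf_map_bij\<close>). For the formula,
  \<open>\<Lambda>\<close> sends both sides to \<open>X \<otimes> 1 \<otimes> 1\<close> (\<open>plus_minus_formula\<close>).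

  All computations take place on representing formal sums. A map out of a tensor product is the
  additive extension \<open>lin g\<close> of a map \<open>g\<close> from pure tensors to formal sums, and it is well defined on
  classes when \<open>g\<close> sends the defining relations to congruences (\<open>preserves\<close>); Sweedler notation
  becomes nested \<open>lin\<close>s.
\<close>

section \<open>Formal sums modulo relations\<close>

definition lin :: "('a \<Rightarrow> 'c multiset) \<Rightarrow> 'a multiset \<Rightarrow> 'c multiset" where
  "lin g z = (\<Sum>a\<in>#z. g a)"

lemma lin_simps [simp]:
  "lin g {#} = {#}"
  "lin g (add_mset a z) = g a + lin g z"
  "lin g (y + z) = lin g y + lin g z"
  by (simp_all add: lin_def)

lemma lin_image [simp]: "lin g (image_mset f z) = lin (\<lambda>a. g (f a)) z"
  by (induction z) auto

lemma lin_lin: "lin g (lin h z) = lin (\<lambda>a. lin g (h a)) z"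
  by (induction z) auto

lemma image_lin: "image_mset f (lin h z) = lin (\<lambda>a. image_mset f (h a)) z"
  by (induction z) auto

lemma lin_singletons: "lin (\<lambda>a. {#f a#}) z = image_mset f z"
  by (induction z) auto

lemma lin_plus: "lin (\<lambda>a. g a + h a) z = lin g z + lin h z"
  by (induction z) auto

lemma lin_empty: "lin (\<lambda>a. {#}) z = {#}"
  by (induction z) auto

lemma lin_swap: "lin (\<lambda>a. lin (\<lambda>b. g a b) w) z = lin (\<lambda>b. lin (\<lambda>a. g a b) z) w"
  by (induction z) (auto simp: lin_plus lin_empty)

lemma lin_cong: "(\<And>a. a \<in># z \<Longrightarrow> g a = h a) \<Longrightarrow> lin g z = lin h z"
  by (induction z) auto

declare tcong.trans [trans]

lemma tclass_eq_iff: "tclass \<rho> x = tclass \<rho> y \<longleftrightarrow> tcong \<rho> x y"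
proof
  assume "tclass \<rho> x = tclass \<rho> y"
  then have "y \<in> tclass \<rho> x" by (simp add: tclass_def tcong.refl)
  then show "tcong \<rho> x y" by (simp add: tclass_def)
next
  assume "tcong \<rho> x y"
  then show "tclass \<rho> x = tclass \<rho> y"
    by (auto simp: tclass_def intro: tcong.trans tcong.sym)
qed

lemma tcong_rep: "tcong \<rho> (rep (tclass \<rho> x)) x"
proof -
  have "x \<in> tclass \<rho> x" by (simp add: tclass_def tcong.refl)
  then have "rep (tclass \<rho> x) \<in> tclass \<rho> x" unfolding rep_def by (rule someI)
  then show ?thesis by (simp add: tclass_def tcong.sym)
qed

lemma tclass_rep: "C \<in> quot \<rho> \<Longrightarrow> tclass \<rho> (rep C) = C"
  unfolding quot_def by (erule rangeE) (simp add: tclass_eq_iff tcong_rep)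

lemma tcong_lin: "(\<And>a. a \<in># z \<Longrightarrow> tcong \<sigma> (g a) (h a)) \<Longrightarrow> tcong \<sigma> (lin g z) (lin h z)"
  by (induction z) (auto intro: tcong.refl tcong.add)

text \<open>
  The universal property of a quotient by relations, in the form used for every map below: it is
  enough to check congruences on the generating relations.
\<close>

definition preserves :: "('a multiset \<times> 'a multiset) set \<Rightarrow> ('c multiset \<times> 'c multiset) set
    \<Rightarrow> ('a \<Rightarrow> 'c multiset) \<Rightarrow> bool" where
  "preserves \<rho> \<sigma> g \<longleftrightarrow> (\<forall>(x, y)\<in>\<rho>. tcong \<sigma> (lin g x) (lin g y))"

lemma preserves_lin: "preserves \<rho> \<sigma> g \<Longrightarrow> tcong \<rho> x y \<Longrightarrow> tcong \<sigma> (lin g x) (lin g y)"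
  by (rotate_tac, induction rule: tcong.induct)
    (auto simp: preserves_def intro: tcong.intros)

lemma preserves_image:
  "preserves \<rho> \<sigma> (\<lambda>a. {#f a#}) \<Longrightarrow> tcong \<rho> x y \<Longrightarrow> tcong \<sigma> (image_mset f x) (image_mset f y)"
  using preserves_lin [of \<rho> \<sigma> "\<lambda>a. {#f a#}"] by (simp add: lin_singletons)

text \<open>
  The quotient of a free commutative monoid by relations is a group exactly if every generator is
  invertible. Invertibility of a single sum is isolated because the tensor relations of a module on a
  proper subset of a type say nothing about generators outside the carrier.
\<close>

definition invertible_in :: "('c multiset \<times> 'c multiset) set \<Rightarrow> 'c multiset \<Rightarrow> bool" where
  "invertible_in \<sigma> x \<longleftrightarrow> (\<exists>w. tcong \<sigma> (x + w) {#})"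

definition group_rel :: "('a multiset \<times> 'a multiset) set \<Rightarrow> bool" where
  "group_rel \<sigma> \<longleftrightarrow> (\<forall>a. invertible_in \<sigma> {#a#})"

lemma group_rel_invertible: "group_rel \<sigma> \<Longrightarrow> invertible_in \<sigma> z"
proof (induction z)
  case empty
  show ?case unfolding invertible_in_def by (rule exI [of _ "{#}"]) (simp add: tcong.refl)
next
  case (add a z)
  then obtain w where "tcong \<sigma> (z + w) {#}" by (auto simp: invertible_in_def)
  moreover obtain v where "tcong \<sigma> ({#a#} + v) {#}"
    using add.prems by (auto simp: group_rel_def invertible_in_def)
  ultimately have *: "tcong \<sigma> ({#a#} + v) {#}" "tcong \<sigma> (z + w) {#}" by simp_all
  from tcong.add [OF *] have "tcong \<sigma> (add_mset a z + (v + w)) {#}"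
    by (simp add: ac_simps)
  then show ?case by (auto simp: invertible_in_def)
qed

text \<open>
  An idempotent in a group is zero. With this, additivity of a map already forces the relations
  \<open>0 \<otimes> n = 0\<close> to be preserved, so they never have to be checked by hand.
\<close>

lemma tcong_zeroI:
  assumes "invertible_in \<sigma> x" "tcong \<sigma> x (x + x)"
  shows "tcong \<sigma> x {#}"
proof -
  from assms(1) obtain w where w: "tcong \<sigma> (x + w) {#}" by (auto simp: invertible_in_def)
  have "tcong \<sigma> x (x + (x + w))"
    using tcong.add [OF tcong.refl [of \<sigma> x] tcong.sym [OF w]] by simp
  also have "tcong \<sigma> (x + (x + w)) (x + w)"
    using tcong.add [OF tcong.sym [OF assms(2)] tcong.refl [of \<sigma> w]] by (simp add: ac_simps)
  also note w
  finally show ?thesis .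
qed

lemma abelian_group_univ_module:
  fixes act :: "'r \<Rightarrow> 'm::ab_group_add \<Rightarrow> 'm"
  shows "abelian_group (univ_module act)"
proof (rule abelian_groupI)
  fix x :: 'm assume "x \<in> carrier (univ_module act)"
  then show "\<exists>y\<in>carrier (univ_module act). y \<oplus>\<^bsub>univ_module act\<^esub> x = \<zero>\<^bsub>univ_module act\<^esub>"
    by (auto simp: univ_module_def intro: exI [of _ "- x"])
qed (auto simp: univ_module_def algebra_simps)

lemma univ_module_simps [simp]:
  "carrier (univ_module act) = UNIV" "x \<oplus>\<^bsub>univ_module act\<^esub> y = x + y"
  "\<zero>\<^bsub>univ_module act\<^esub> = 0" "r \<odot>\<^bsub>univ_module act\<^esub> x = act r x"
  by (auto simp: univ_module_def)

lemma ring_of_simps [simp]: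
  "carrier (ring_of S) = S" "x \<otimes>\<^bsub>ring_of S\<^esub> y = x * y" "x \<oplus>\<^bsub>ring_of S\<^esub> y = x + y"
  "\<one>\<^bsub>ring_of S\<^esub> = 1" "\<zero>\<^bsub>ring_of S\<^esub> = 0"
  by (auto simp: ring_of_def)

lemma ring_ring_of: "ring (ring_of UNIV)"
proof (rule ringI)
  show "abelian_group (ring_of (UNIV :: 'a set))"
  proof (rule abelian_groupI)
    fix x :: 'a assume "x \<in> carrier (ring_of UNIV)"
    show "\<exists>y\<in>carrier (ring_of UNIV). y \<oplus>\<^bsub>ring_of UNIV\<^esub> x = \<zero>\<^bsub>ring_of UNIV\<^esub>"
      by (auto intro: exI [of _ "- x"])
  qed (auto simp: algebra_simps)
  show "Group.monoid (ring_of (UNIV :: 'a set))"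
    by (rule monoidI) (auto simp: algebra_simps)
qed (auto simp: algebra_simps)

lemma preserves_tensor_rel:
  assumes X: "abelian_group X" and M: "abelian_group M"
    and inv: "\<And>x m. x \<in> carrier X \<Longrightarrow> m \<in> carrier M \<Longrightarrow> invertible_in \<sigma> (g (x, m))"
    and l: "\<And>x x' m. x \<in> carrier X \<Longrightarrow> x' \<in> carrier X \<Longrightarrow> m \<in> carrier M \<Longrightarrow>
      tcong \<sigma> (g (x \<oplus>\<^bsub>X\<^esub> x', m)) (g (x, m) + g (x', m))"
    and r: "\<And>x m m'. x \<in> carrier X \<Longrightarrow> m \<in> carrier M \<Longrightarrow> m' \<in> carrier M \<Longrightarrow>
      tcong \<sigma> (g (x, m \<oplus>\<^bsub>M\<^esub> m')) (g (x, m) + g (x, m'))"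
    and b: "\<And>s x m. s \<in> S \<Longrightarrow> x \<in> carrier X \<Longrightarrow> m \<in> carrier M \<Longrightarrow>
      tcong \<sigma> (g (s \<odot>\<^bsub>X\<^esub> x, m)) (g (x, s \<odot>\<^bsub>M\<^esub> m))"
  shows "preserves (tensor_rel S X M) \<sigma> g"
proof -
  interpret X: abelian_group X by fact
  interpret M: abelian_group M by fact
  have z: "tcong \<sigma> (g (\<zero>\<^bsub>X\<^esub>, m)) {#}" if "m \<in> carrier M" for m
    using l [of "\<zero>\<^bsub>X\<^esub>" "\<zero>\<^bsub>X\<^esub>" m] that by (intro tcong_zeroI inv) auto
  have z': "tcong \<sigma> (g (x, \<zero>\<^bsub>M\<^esub>)) {#}" if "x \<in> carrier X" for x
    using r [of x "\<zero>\<^bsub>M\<^esub>" "\<zero>\<^bsub>M\<^esub>"] that by (intro tcong_zeroI inv) auto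
  show ?thesis unfolding preserves_def
    by (auto elim!: tensor_rel.cases intro: l r b z z')
qed

lemma preserves_tensor_univ:
  assumes "\<And>x m. invertible_in \<sigma> (g (x, m))"
    and "\<And>x x' m. tcong \<sigma> (g (x + x', m)) (g (x, m) + g (x', m))"
    and "\<And>x m m'. tcong \<sigma> (g (x, m + m')) (g (x, m) + g (x, m'))"
    and "\<And>s x m. s \<in> S \<Longrightarrow> tcong \<sigma> (g (aX s x, m)) (g (x, aM s m))"
  shows "preserves (tensor_rel S (univ_module aX) (univ_module aM)) \<sigma> g"
  by (rule preserves_tensor_rel) (use assms in \<open>simp_all add: abelian_group_univ_module\<close>)

lemma
  shows tensor_univ_add_left:
      "tcong (tensor_rel S (univ_module aX) (univ_module aM)) {#(x + x', m)#} {#(x, m), (x', m)#}"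
    and tensor_univ_add_right:
      "tcong (tensor_rel S (univ_module aX) (univ_module aM)) {#(x, m + m')#} {#(x, m), (x, m')#}"
    and tensor_univ_zero_left:
      "tcong (tensor_rel S (univ_module aX) (univ_module aM)) {#(0, m)#} {#}"
    and tensor_univ_balanced:
      "s \<in> S \<Longrightarrow> tcong (tensor_rel S (univ_module aX) (univ_module aM)) {#(aX s x, m)#} {#(x, aM s m)#}"
  by (rule tcong.base; use tensor_rel.intros [where X = "univ_module aX" and M = "univ_module aM"]
      in simp)+

lemma group_tensor_univ: "group_rel (tensor_rel S (univ_module aX) (univ_module aM))"
  unfolding group_rel_def
proof safe
  fix x m
  let ?\<rho> = "tensor_rel S (univ_module aX) (univ_module aM)"
  have "tcong ?\<rho> ({#(x, m)#} + {#(- x, m)#}) {#(x + (- x), m)#}"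
    using tcong.sym [OF tensor_univ_add_left [of S aX aM x "- x" m]] by (simp add: add_mset_commute)
  also have "tcong ?\<rho> \<dots> {#}" using tensor_univ_zero_left [of S aX aM m] by simp
  finally show "invertible_in ?\<rho> {#(x, m)#}" unfolding invertible_in_def by blast
qed

lemma tcong_lin_plus:
  assumes "\<And>a. a \<in># z \<Longrightarrow> tcong \<sigma> (g a) (h a + k a)"
  shows "tcong \<sigma> (lin g z) (lin h z + lin k z)"
  unfolding lin_plus [symmetric] using assms by (rule tcong_lin)

lemma tcong_mono: "tcong \<rho> x y \<Longrightarrow> \<rho> \<subseteq> \<sigma> \<Longrightarrow> tcong \<sigma> x y"
  by (induction rule: tcong.induct) (auto intro: tcong.intros)

lemma group_rel_mono: "group_rel \<rho> \<Longrightarrow> \<rho> \<subseteq> \<sigma> \<Longrightarrow> group_rel \<sigma>"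
  unfolding group_rel_def invertible_in_def by (meson tcong_mono)

lemma preserves_tensor3:
  assumes inv: "\<And>m n q. invertible_in \<sigma> (g (m, n, q))"
    and add1: "\<And>m m' n q. tcong \<sigma> (g (m + m', n, q)) (g (m, n, q) + g (m', n, q))"
    and add2: "\<And>m n n' q. tcong \<sigma> (g (m, n + n', q)) (g (m, n, q) + g (m, n', q))"
    and add3: "\<And>m n q q'. tcong \<sigma> (g (m, n, q + q')) (g (m, n, q) + g (m, n, q'))"
    and scale12: "\<And>c m n q. tcong \<sigma> (g (kM c m, n, q)) (g (m, kN c n, q))"
    and scale23: "\<And>c m n q. tcong \<sigma> (g (m, kN c n, q)) (g (m, n, kQ c q))"
  shows "preserves (tensor3_rel kM kN kQ) \<sigma> g"
proof -
  have z: "tcong \<sigma> (g (0, n, q)) {#}" "tcong \<sigma> (g (m, 0, q)) {#}" "tcong \<sigma> (g (m, n, 0)) {#}" for m n q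
    using add1 [of 0 0] add2 [of _ 0 0] add3 [of _ _ 0 0] by (auto intro!: tcong_zeroI inv)
  show ?thesis unfolding preserves_def
    by (auto elim!: tensor3_rel.cases intro: add1 add2 add3 scale12 scale23 z)
qed

lemma group_tensor3: "group_rel (tensor3_rel kM kN kQ)"
  unfolding group_rel_def
proof safe
  fix m n q
  let ?\<rho> = "tensor3_rel kM kN kQ"
  have "tcong ?\<rho> ({#(m, n, q)#} + {#(- m, n, q)#}) {#(m + (- m), n, q)#}"
    using tcong.sym [OF tcong.base [OF tensor3_rel.add1 [of m "- m" n q]]]
    by (simp add: add_mset_commute)
  also have "tcong ?\<rho> \<dots> {#}" using tcong.base [OF tensor3_rel.zero1 [of n q]] by simp
  finally show "invertible_in ?\<rho> {#(m, n, q)#}" unfolding invertible_in_def by blast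
qed

lemma tcong_sumI: "tcong \<sigma> {#a#} {#b, c#} \<Longrightarrow> tcong \<sigma> {#a#} ({#b#} + {#c#})"
  by (simp add: add_mset_commute)

lemma mult_sum_lin:
  "mult_sum z w = lin (\<lambda>(x, y). lin (\<lambda>(x', y'). {#(x * x', y * y')#}) w) z"
  by (induction z) (auto simp: mult_sum_def split_def lin_singletons)

text \<open>
  The product formula read with the second factor in the outer sum, as needed when the representative
  of the second factor is to be changed.
\<close>

lemma mult_sum_swap:
  "mult_sum z w = lin (\<lambda>(x', y'). lin (\<lambda>(x, y). {#(x * x', y * y')#}) z) w"
  unfolding mult_sum_lin split_def by (rule lin_swap)

section \<open>Descent along a faithfully flat module\<close>

text \<open>
  Exactness at the ends of a sequence needs a zero module on the same type as the given one.
\<close>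

lemma (in right_module) zero_submodule: "right_module R (M\<lparr>carrier := {\<zero>\<^bsub>M\<^esub>}\<rparr>)"
proof -
  have z: "r \<odot>\<^bsub>M\<^esub> \<zero>\<^bsub>M\<^esub> = \<zero>\<^bsub>M\<^esub>" if "r \<in> carrier R" for r
  proof -
    have "r \<odot>\<^bsub>M\<^esub> \<zero>\<^bsub>M\<^esub> \<oplus>\<^bsub>M\<^esub> r \<odot>\<^bsub>M\<^esub> \<zero>\<^bsub>M\<^esub> = r \<odot>\<^bsub>M\<^esub> \<zero>\<^bsub>M\<^esub>"
      using smult_r_distr [OF that, of "\<zero>\<^bsub>M\<^esub>" "\<zero>\<^bsub>M\<^esub>"] by simp
    then show ?thesis using smult_closed [OF that M.zero_closed] by (metis M.add.l_cancel_one')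
  qed
  have "abelian_group (M\<lparr>carrier := {\<zero>\<^bsub>M\<^esub>}\<rparr>)"
    by (rule abelian_groupI) auto
  then show ?thesis
    by (auto simp: right_module_def right_module_axioms_def z R.ring_axioms)
qed

lemma module_maps_zero:
  assumes "abelian_group X" "abelian_group Y" "f \<in> module_maps R X Y"
  shows "f \<zero>\<^bsub>X\<^esub> = \<zero>\<^bsub>Y\<^esub>"
proof -
  interpret X: abelian_group X by fact
  interpret Y: abelian_group Y by fact
  have *: "f \<zero>\<^bsub>X\<^esub> \<in> carrier Y" "f (\<zero>\<^bsub>X\<^esub> \<oplus>\<^bsub>X\<^esub> \<zero>\<^bsub>X\<^esub>) = f \<zero>\<^bsub>X\<^esub> \<oplus>\<^bsub>Y\<^esub> f \<zero>\<^bsub>X\<^esub>"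
    using assms(3) X.zero_closed unfolding module_maps_def by blast+
  have "f \<zero>\<^bsub>X\<^esub> \<oplus>\<^bsub>Y\<^esub> f \<zero>\<^bsub>X\<^esub> = f \<zero>\<^bsub>X\<^esub> \<oplus>\<^bsub>Y\<^esub> \<zero>\<^bsub>Y\<^esub>"
    using * by simp
  then show ?thesis
    using *(1) by (simp only: Y.add.Units_l_cancel Y.add.Units_eq Y.zero_closed)
qed

lemma tcong_swapI: "({#a#}, {#b, c#}) \<in> \<rho> \<Longrightarrow> tcong \<rho> {#a#} {#c, b#}"
  by (simp add: tcong.base add_mset_commute)

lemma tensor_map_tclass:
  assumes "abelian_group X" "abelian_group Y" "f \<in> module_maps R X Y"
  shows "tensor_map R Y M f (tclass (tensor_rel (carrier R) X M) z) =
    tclass (tensor_rel (carrier R) Y M) (image_mset (\<lambda>(x, m). (f x, m)) z)"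
proof -
  have fc: "f x \<in> carrier Y" if "x \<in> carrier X" for x
    using assms(3) that unfolding module_maps_def by auto
  have f: "f (x \<oplus>\<^bsub>X\<^esub> y) = f x \<oplus>\<^bsub>Y\<^esub> f y" if "x \<in> carrier X" "y \<in> carrier X" for x y
    using assms(3) that unfolding module_maps_def by auto
  have fs: "f (r \<odot>\<^bsub>X\<^esub> x) = r \<odot>\<^bsub>Y\<^esub> f x" if "r \<in> carrier R" "x \<in> carrier X" for r x
    using assms(3) that unfolding module_maps_def by auto
  have "preserves (tensor_rel (carrier R) X M) (tensor_rel (carrier R) Y M) (\<lambda>(x, m). {#(f x, m)#})"
    unfolding preserves_def
    by (auto elim!: tensor_rel.cases simp: f fs fc module_maps_zero [OF assms]
        intro!: tcong_swapI [OF tensor_rel.add_left] tcong_swapI [OF tensor_rel.add_right]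
          tcong.base [OF tensor_rel.zero_left] tcong.base [OF tensor_rel.zero_right]
          tcong.base [OF tensor_rel.balanced])
  from preserves_lin [OF this tcong_rep]
  show ?thesis unfolding tensor_map_def tclass_eq_iff by (simp add: lin_singletons split_def)
qed

lemma tensor_zero_left:
  assumes "set_mset z \<subseteq> {\<zero>\<^bsub>X\<^esub>} \<times> carrier M"
  shows "tcong (tensor_rel S X M) z {#}"
  using assms
proof (induction z)
  case (add a z)
  then obtain m where "a = (\<zero>\<^bsub>X\<^esub>, m)" "m \<in> carrier M" by auto
  then have "tcong (tensor_rel S X M) {#a#} {#}" by (auto intro: tcong.base tensor_rel.zero_left)
  from tcong.add [OF this add.IH] add.prems show ?case by auto
qed (rule tcong.refl)

text \<open>
  The two consequences of faithful flatness used here: a module map is injective, or surjective, if it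
  becomes so after tensoring. They are exactness of \<open>0 \<rightarrow> Y \<rightarrow> Z\<close> and of \<open>Y \<rightarrow> Z \<rightarrow> 0\<close>.
\<close>

locale faithfully_flat_test =
  fixes R :: "'r ring" and M :: "('r, 'm) module" and Y Z :: "('r, 'u) module" and g :: "'u \<Rightarrow> 'u"
  assumes flat: "faithfully_flat TYPE('u) R M"
    and Y: "right_module R Y" and Z: "right_module R Z" and g: "g \<in> module_maps R Y Z"
begin

sublocale Y: right_module R Y by (rule Y)
sublocale Z: right_module R Z by (rule Z)

lemma exact_iff:
  fixes X Y' Z' :: "('r, 'u) module"
  assumes "right_module R X" "right_module R Y'" "right_module R Z'" "f \<in> module_maps R X Y'" "h \<in> module_maps R Y' Z'"
  shows "f ` carrier X = {y \<in> carrier Y'. h y = \<zero>\<^bsub>Z'\<^esub>} \<longleftrightarrow>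
         tensor_map R Y' M f ` tensor R X M =
           {C \<in> tensor R Y' M. tensor_map R Z' M h C = tclass (tensor_rel (carrier R) Z' M) {#}}"
  using flat assms unfolding faithfully_flat_def by blast

lemma inj_onI_tensor:
  assumes ker: "\<And>z. set_mset z \<subseteq> carrier Y \<times> carrier M \<Longrightarrow>
      tcong (tensor_rel (carrier R) Z M) (image_mset (\<lambda>(y, m). (g y, m)) z) {#} \<Longrightarrow>
      tcong (tensor_rel (carrier R) Y M) z {#}"
  shows "inj_on g (carrier Y)"
proof -
  \<comment> \<open>the sequence \<open>0 \<rightarrow> Y \<rightarrow> Z\<close>\<close>
  let ?X = "Y\<lparr>carrier := {\<zero>\<^bsub>Y\<^esub>}\<rparr>"
  let ?\<rho> = "tensor_rel (carrier R) Y M"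
  have X: "right_module R ?X" by (rule Y.zero_submodule)
  then interpret X: right_module R ?X .
  have id: "id \<in> module_maps R ?X Y" by (simp add: module_maps_def)
  have "tensor_map R Y M id ` tensor R ?X M = {tclass ?\<rho> {#}}"
  proof -
    have "tensor_map R Y M id (tclass (tensor_rel (carrier R) ?X M) z) = tclass ?\<rho> {#}"
      if "set_mset z \<subseteq> {\<zero>\<^bsub>Y\<^esub>} \<times> carrier M" for z
      using tensor_zero_left [OF that]
      by (simp add: tensor_map_tclass [OF X.M.abelian_group_axioms Y.M.abelian_group_axioms id] tclass_eq_iff)
    then have "tensor_map R Y M id ` tensor R ?X M \<subseteq> {tclass ?\<rho> {#}}"
      by (auto simp: tensor_def)
    moreover have "tensor R ?X M \<noteq> {}"
      using exI [of "\<lambda>z. set_mset z \<subseteq> _" "{#}"] by (auto simp: tensor_def)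
    ultimately show ?thesis by blast
  qed
  moreover have "{C \<in> tensor R Y M. tensor_map R Z M g C = tclass (tensor_rel (carrier R) Z M) {#}} = {tclass ?\<rho> {#}}"
  proof -
    have t: "tensor_map R Z M g (tclass ?\<rho> z) = tclass (tensor_rel (carrier R) Z M) {#} \<longleftrightarrow>
        tcong (tensor_rel (carrier R) Z M) (image_mset (\<lambda>(y, m). (g y, m)) z) {#}" for z
      by (simp add: tensor_map_tclass [OF Y.M.abelian_group_axioms Z.M.abelian_group_axioms g] tclass_eq_iff)
    have "tclass ?\<rho> {#} \<in> tensor R Y M"
      unfolding tensor_def by (rule image_eqI [of _ _ "{#}"]) auto
    moreover have "C = tclass ?\<rho> {#}"
      if "C \<in> tensor R Y M" "tensor_map R Z M g C = tclass (tensor_rel (carrier R) Z M) {#}" for C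
    proof -
      obtain z where z: "set_mset z \<subseteq> carrier Y \<times> carrier M" "C = tclass ?\<rho> z"
        using \<open>C \<in> tensor R Y M\<close> unfolding tensor_def by blast
      then show ?thesis using that(2) ker [OF z(1)] by (simp only: t tclass_eq_iff)
    qed
    moreover have "tensor_map R Z M g (tclass ?\<rho> {#}) = tclass (tensor_rel (carrier R) Z M) {#}"
      by (simp only: t image_mset_empty tcong.refl)
    ultimately show ?thesis by blast
  qed
  ultimately have "id ` carrier ?X = {y \<in> carrier Y. g y = \<zero>\<^bsub>Z\<^esub>}"
    using exact_iff [OF X Y Z id g] by simp
  then have k: "y = \<zero>\<^bsub>Y\<^esub>" if "y \<in> carrier Y" "g y = \<zero>\<^bsub>Z\<^esub>" for y
    using that by auto
  show ?thesis
  proof (rule inj_onI)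
    fix x y assume xy: "x \<in> carrier Y" "y \<in> carrier Y" "g x = g y"
    have gc: "g u \<in> carrier Z" if "u \<in> carrier Y" for u
      using g that by (auto simp: module_maps_def)
    have "(x \<ominus>\<^bsub>Y\<^esub> y) \<oplus>\<^bsub>Y\<^esub> y = x"
      using xy by (simp add: Y.M.minus_eq Y.M.a_assoc Y.M.l_neg)
    then have "g (x \<ominus>\<^bsub>Y\<^esub> y) \<oplus>\<^bsub>Z\<^esub> g y = g y"
      using g xy unfolding module_maps_def by (metis (mono_tags, lifting) Y.M.minus_closed mem_Collect_eq)
    then have "g (x \<ominus>\<^bsub>Y\<^esub> y) = \<zero>\<^bsub>Z\<^esub>"
      using xy gc by (metis Y.M.minus_closed Z.M.add.r_cancel_one')
    then have "x \<ominus>\<^bsub>Y\<^esub> y = \<zero>\<^bsub>Y\<^esub>" using xy by (intro k) auto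
    then show "x = y"
      using xy \<open>(x \<ominus>\<^bsub>Y\<^esub> y) \<oplus>\<^bsub>Y\<^esub> y = x\<close> by simp
  qed
qed

lemma surjI_tensor:
  assumes sur: "\<And>z. set_mset z \<subseteq> carrier Z \<times> carrier M \<Longrightarrow>
      \<exists>w. set_mset w \<subseteq> carrier Y \<times> carrier M \<and>
        tcong (tensor_rel (carrier R) Z M) (image_mset (\<lambda>(y, m). (g y, m)) w) z"
  shows "g ` carrier Y = carrier Z"
proof -
  \<comment> \<open>the sequence \<open>Y \<rightarrow> Z \<rightarrow> 0\<close>\<close>
  let ?X = "Z\<lparr>carrier := {\<zero>\<^bsub>Z\<^esub>}\<rparr>"
  have X: "right_module R ?X" by (rule Z.zero_submodule)
  then interpret X: right_module R ?X .
  let ?h = "\<lambda>_. \<zero>\<^bsub>Z\<^esub>"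
  have h: "?h \<in> module_maps R Z ?X"
    using X.smult_closed by (auto simp: module_maps_def)
  have "tensor_map R Z M g ` tensor R Y M \<supseteq> tensor R Z M"
  proof
    fix C assume "C \<in> tensor R Z M"
    then obtain z where z: "set_mset z \<subseteq> carrier Z \<times> carrier M" "C = tclass (tensor_rel (carrier R) Z M) z"
      unfolding tensor_def by blast
    from sur [OF z(1)] obtain w where w: "set_mset w \<subseteq> carrier Y \<times> carrier M"
      "tcong (tensor_rel (carrier R) Z M) (image_mset (\<lambda>(y, m). (g y, m)) w) z" by blast
    then have "C = tensor_map R Z M g (tclass (tensor_rel (carrier R) Y M) w)"
      by (simp only: z(2) tensor_map_tclass [OF Y.M.abelian_group_axioms Z.M.abelian_group_axioms g]
          tclass_eq_iff tcong.sym)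
    then show "C \<in> tensor_map R Z M g ` tensor R Y M"
      using w(1) unfolding tensor_def by blast
  qed
  moreover have "tensor_map R Z M g ` tensor R Y M \<subseteq> tensor R Z M"
  proof -
    have "tensor_map R Z M g (tclass (tensor_rel (carrier R) Y M) w) \<in> tensor R Z M"
      if "set_mset w \<subseteq> carrier Y \<times> carrier M" for w
      unfolding tensor_map_tclass [OF Y.M.abelian_group_axioms Z.M.abelian_group_axioms g] tensor_def
      using that g by (intro imageI) (auto simp: module_maps_def)
    then show ?thesis by (auto simp: tensor_def)
  qed
  moreover have "tensor_map R ?X M ?h C = tclass (tensor_rel (carrier R) ?X M) {#}" if "C \<in> tensor R Z M" for C
  proof -
    obtain z where z: "set_mset z \<subseteq> carrier Z \<times> carrier M" "C = tclass (tensor_rel (carrier R) Z M) z"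
      using \<open>C \<in> tensor R Z M\<close> by (auto simp: tensor_def)
    have "tcong (tensor_rel (carrier R) ?X M) (image_mset (\<lambda>(x, m). (?h x, m)) z) {#}"
      using z(1) by (intro tensor_zero_left) auto
    then show ?thesis
      by (simp add: z(2) tensor_map_tclass [OF Z.M.abelian_group_axioms X.M.abelian_group_axioms h] tclass_eq_iff)
  qed
  ultimately have "g ` carrier Y = {z \<in> carrier Z. ?h z = \<zero>\<^bsub>?X\<^esub>}"
    using exact_iff [OF Y Z X g h] by auto
  then show ?thesis by simp
qed

end

section \<open>Modules presented by formal sums\<close>

text \<open>
  Faithful flatness can only be tested on modules living on one given type. A module presented by
  relations \<open>\<rho>\<close> on formal sums is therefore carried to the range of a map \<open>q\<close> that separates exactly the
  congruence classes.
\<close>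

locale presented_module =
  fixes \<rho> :: "('a multiset \<times> 'a multiset) set" and q :: "'a multiset \<Rightarrow> 'u"
    and act :: "'b::{ring,monoid_mult} \<Rightarrow> 'a \<Rightarrow> 'a"
  assumes group: "group_rel \<rho>"
    and q_iff: "q z = q w \<longleftrightarrow> tcong \<rho> z w"
    and act_preserves: "preserves \<rho> \<rho> (\<lambda>a. {#act b a#})"
    and act_add: "tcong \<rho> {#act (b + c) a#} ({#act b a#} + {#act c a#})"
    and act_mult: "act (b * c) a = act c (act b a)"
    and act_one: "act 1 a = a"
begin

abbreviation pick :: "'u \<Rightarrow> 'a multiset" where "pick \<equiv> inv_into UNIV q"

definition carried_module :: "('b, 'u) module" where
  "carried_module = \<lparr>carrier = range q, mult = undefined, one = undefined, zero = q {#},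
     add = (\<lambda>x y. q (pick x + pick y)), smult = (\<lambda>b x. q (image_mset (act b) (pick x)))\<rparr>"

lemma inv_q: "tcong \<rho> (pick (q z)) z"
  by (simp add: q_iff [symmetric] f_inv_into_f)

lemma carried_module_simps [simp]:
  "carrier carried_module = range q"
  "\<zero>\<^bsub>carried_module\<^esub> = q {#}"
  "q z \<oplus>\<^bsub>carried_module\<^esub> q w = q (z + w)"
  "b \<odot>\<^bsub>carried_module\<^esub> q z = q (image_mset (act b) z)"
  by (simp_all add: carried_module_def q_iff tcong.add inv_q preserves_image [OF act_preserves])

lemma right_module: "right_module (ring_of UNIV) carried_module"
proof -
  have "abelian_group carried_module"
  proof (rule abelian_groupI)
    fix x assume "x \<in> carrier carried_module"
    then obtain z where z: "x = q z" by auto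
    obtain w where "tcong \<rho> (z + w) {#}"
      using group_rel_invertible [OF group] by (auto simp: invertible_in_def)
    then have "q w \<oplus>\<^bsub>carried_module\<^esub> x = \<zero>\<^bsub>carried_module\<^esub>"
      by (simp add: z q_iff add.commute)
    then show "\<exists>y\<in>carrier carried_module. y \<oplus>\<^bsub>carried_module\<^esub> x = \<zero>\<^bsub>carried_module\<^esub>" by auto
  qed (auto simp: ac_simps)
  moreover have mult: "image_mset (act (b * c)) z = image_mset (act c) (image_mset (act b) z)" for b c z
    by (simp add: multiset.map_comp comp_def act_mult [abs_def] cong: image_mset_cong)
  have one: "image_mset (act 1) z = z" for z
    using ext [of "act 1" "\<lambda>a. a", OF act_one] by simp
  have add: "q (image_mset (act (b + c)) z) = q (image_mset (act b) z + image_mset (act c) z)" for b c z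
    using tcong_lin [of z \<rho> "\<lambda>a. {#act (b + c) a#}" "\<lambda>a. {#act b a#} + {#act c a#}"] act_add
    by (simp add: q_iff lin_plus lin_singletons
        del: add_mset_add_single union_mset_add_mset_left union_mset_add_mset_right)
  have "right_module_axioms (ring_of UNIV) carried_module"
  proof (rule right_module_axioms.intro)
    fix b c x assume "x \<in> carrier carried_module"
    then obtain z where x: "x = q z" by auto
    show "(b \<oplus>\<^bsub>ring_of UNIV\<^esub> c) \<odot>\<^bsub>carried_module\<^esub> x =
        b \<odot>\<^bsub>carried_module\<^esub> x \<oplus>\<^bsub>carried_module\<^esub> c \<odot>\<^bsub>carried_module\<^esub> x"
      by (simp add: x add)
    show "(b \<otimes>\<^bsub>ring_of UNIV\<^esub> c) \<odot>\<^bsub>carried_module\<^esub> x =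
        c \<odot>\<^bsub>carried_module\<^esub> (b \<odot>\<^bsub>carried_module\<^esub> x)"
      by (simp add: x mult)
  qed (auto simp: one)
  ultimately show ?thesis by (simp add: right_module_def ring_ring_of)
qed

context
  fixes sP :: "'b \<Rightarrow> 'p::ab_group_add \<Rightarrow> 'p"
begin

abbreviation tensor_P where
  "tensor_P \<equiv> tensor_rel UNIV carried_module (univ_module sP)"

lemma tensor_P_rules:
  shows tensor_P_add_left: "tcong tensor_P {#(q (z + w), p)#} ({#(q z, p)#} + {#(q w, p)#})"
    and tensor_P_add_right: "tcong tensor_P {#(q z, p + p')#} ({#(q z, p)#} + {#(q z, p')#})"
    and tensor_P_zero_left: "tcong tensor_P {#(q {#}, p)#} {#}"
    and tensor_P_zero_right: "tcong tensor_P {#(q z, 0)#} {#}"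
    and "tcong tensor_P {#(q (image_mset (act b) z), p)#} {#(q z, sP b p)#}"
proof -
  note t = tensor_rel.intros [where X = carried_module and M = "univ_module sP"]
  show "tcong tensor_P {#(q (z + w), p)#} ({#(q z, p)#} + {#(q w, p)#})"
    using tcong.base [OF t(1) [of "q z" "q w" p UNIV]] by (simp add: add_mset_commute)
  show "tcong tensor_P {#(q z, p + p')#} ({#(q z, p)#} + {#(q z, p')#})"
    using tcong.base [OF t(2) [of "q z" p p' UNIV]] by (simp add: add_mset_commute)
  show "tcong tensor_P {#(q {#}, p)#} {#}" using tcong.base [OF t(3) [of p UNIV]] by simp
  show "tcong tensor_P {#(q z, 0)#} {#}" using tcong.base [OF t(4) [of "q z" UNIV]] by simp
  show "tcong tensor_P {#(q (image_mset (act b) z), p)#} {#(q z, sP b p)#}"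
    using tcong.base [OF t(5) [of b UNIV "q z" p]] by simp
qed

lemma tensor_P_invertible: "invertible_in tensor_P {#(q z, p)#}"
proof -
  have "tcong tensor_P ({#(q z, p)#} + {#(q z, - p)#}) {#(q z, p + - p)#}"
    by (rule tcong.sym [OF tensor_P_add_right])
  also have "tcong tensor_P \<dots> {#}" using tensor_P_zero_right by simp
  finally show ?thesis unfolding invertible_in_def by blast
qed

text \<open>
  With \<open>Q\<close> the module presented by \<open>\<rho>\<close>, \<open>expand\<close> and \<open>collect\<close> translate between formal sums in
  \<open>Q \<times> P\<close> and formal sums of generators paired with elements of \<open>P\<close>. The pairing \<open>j\<close> is a parameter so
  that the result can be a nested triple.
\<close>

definition expand :: "('a \<Rightarrow> 'p \<Rightarrow> 'c) \<Rightarrow> 'u \<times> 'p \<Rightarrow> 'c multiset" where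
  "expand j = (\<lambda>(y, p). image_mset (\<lambda>a. j a p) (pick y))"

definition collect :: "'a \<Rightarrow> 'p \<Rightarrow> 'u \<times> 'p" where
  "collect a p = (q {#a#}, p)"

lemma collect_sum: "tcong tensor_P (image_mset (\<lambda>a. collect a p) z) {#(q z, p)#}"
proof (induction z)
  case empty
  show ?case using tcong.sym [OF tensor_P_zero_left] by simp
next
  case (add a z)
  have "tcong tensor_P ({#(q {#a#}, p)#} + {#(q z, p)#}) {#(q ({#a#} + z), p)#}"
    by (rule tcong.sym [OF tensor_P_add_left])
  then show ?case
    using tcong.trans [OF tcong.add [OF tcong.refl [of _ "{#(q {#a#}, p)#}"] add.IH]]
    by (simp add: collect_def)
qed

lemma expand_collect:
  assumes "set_mset z \<subseteq> range q \<times> UNIV"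
  shows "tcong tensor_P (lin (expand collect) z) z"
proof -
  have "tcong tensor_P (expand collect t) {#t#}" if "t \<in># z" for t
  proof -
    have "t \<in> range q \<times> UNIV" using assms that by blast
    then obtain w p where t: "t = (q w, p)" by auto
    show ?thesis using collect_sum [of p "pick (q w)"] by (simp add: t expand_def f_inv_into_f)
  qed
  then have "tcong tensor_P (lin (expand collect) z) (lin (\<lambda>t. {#t#}) z)" by (rule tcong_lin)
  then show ?thesis by (simp add: lin_singletons)
qed

lemma expand_preserves:
  assumes \<sigma>: "group_rel \<sigma>"
    and l: "\<And>p. preserves \<rho> \<sigma> (\<lambda>a. {#j a p#})"
    and r: "\<And>a p p'. tcong \<sigma> {#j a (p + p')#} ({#j a p#} + {#j a p'#})"
    and b: "\<And>a b p. tcong \<sigma> {#j (act b a) p#} {#j a (sP b p)#}"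
  shows "preserves tensor_P \<sigma> (expand j)"
proof (rule preserves_tensor_rel)
  interpret right_module "ring_of UNIV" carried_module by (rule right_module)
  show "abelian_group carried_module" by (rule M.abelian_group_axioms)
  have e: "tcong \<sigma> (expand j (q z, p)) (image_mset (\<lambda>a. j a p) z)" for z p
    using preserves_image [OF l inv_q] by (simp add: expand_def)
  {
    fix x x' p assume "x \<in> carrier carried_module" "x' \<in> carrier carried_module"
    then obtain z z' where x: "x = q z" "x' = q z'" by auto
    have "tcong \<sigma> (expand j (q (z + z'), p)) (image_mset (\<lambda>a. j a p) z + image_mset (\<lambda>a. j a p) z')"
      using e [of "z + z'"] by simp
    also have "tcong \<sigma> \<dots> (expand j (q z, p) + expand j (q z', p))"
      by (intro tcong.add tcong.sym [OF e])
    finally show "tcong \<sigma> (expand j (x \<oplus>\<^bsub>carried_module\<^esub> x', p)) (expand j (x, p) + expand j (x', p))"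
      by (simp add: x)
  next
    fix x p p'
    have "tcong \<sigma> (lin (\<lambda>a. {#j a (p + p')#}) (pick x)) (lin (\<lambda>a. {#j a p#}) (pick x) + lin (\<lambda>a. {#j a p'#}) (pick x))"
      by (intro tcong_lin_plus r)
    then show "tcong \<sigma> (expand j (x, p \<oplus>\<^bsub>univ_module sP\<^esub> p')) (expand j (x, p) + expand j (x, p'))"
      by (simp add: expand_def lin_singletons)
  next
    fix b x p assume "x \<in> carrier carried_module"
    then obtain z where x: "x = q z" by auto
    have "tcong \<sigma> (expand j (q (image_mset (act b) z), p)) (lin (\<lambda>a. {#j (act b a) p#}) z)"
      using e [of "image_mset (act b) z" p] by (simp add: lin_singletons multiset.map_comp comp_def)
    also have "tcong \<sigma> \<dots> (lin (\<lambda>a. {#j a (sP b p)#}) z)" by (intro tcong_lin b)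
    also have "tcong \<sigma> \<dots> (expand j (q z, sP b p))"
      using tcong.sym [OF e [of z "sP b p"]] by (simp add: lin_singletons)
    finally show "tcong \<sigma> (expand j (b \<odot>\<^bsub>carried_module\<^esub> x, p)) (expand j (x, b \<odot>\<^bsub>univ_module sP\<^esub> p))"
      by (simp add: x)
  }
qed (auto simp: abelian_group_univ_module group_rel_invertible [OF \<sigma>])

end

end

text \<open>
  A class of formal sums, sent injectively to the set of all lists that enumerate its members, the two
  components of each pair being written one after the other.
\<close>

definition encode :: "('l \<times> 'l) multiset set \<Rightarrow> ('b, 'l, 'p) test_universe" where
  "encode C = (\<lambda>xs. concat (map (\<lambda>(x, y). [Inr (Inl x), Inr (Inl y)]) xs)) ` {xs. mset xs \<in> C}"

lemma inj_encode: "inj (encode :: ('l \<times> 'l) multiset set \<Rightarrow> ('b, 'l, 'p) test_universe)"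
proof -
  let ?flat = "\<lambda>xs :: ('l \<times> 'l) list. concat (map (\<lambda>(x, y). [Inr (Inl x) :: 'b + 'l + 'p, Inr (Inl y)]) xs)"
  have inj: "inj ?flat"
  proof (rule injI)
    fix xs ys assume "?flat xs = ?flat ys"
    then show "xs = ys"
    proof (induction xs arbitrary: ys)
      case Nil then show ?case by (cases ys) auto
    next
      case (Cons a xs) then show ?case by (cases ys; cases a) auto
    qed
  qed
  show ?thesis
  proof (rule injI)
    fix C D :: "('l \<times> 'l) multiset set"
    assume "(encode C :: ('b, 'l, 'p) test_universe) = encode D"
    then have "{xs. mset xs \<in> C} = {xs. mset xs \<in> D}"
      using inj_image_eq_iff [OF inj] by (simp add: encode_def)
    then have mset: "mset xs \<in> C \<longleftrightarrow> mset xs \<in> D" for xs by blast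
    show "C = D"
    proof (rule Set.set_eqI)
      fix z :: "('l \<times> 'l) multiset"
      obtain xs where "mset xs = z" using ex_mset by blast
      then show "z \<in> C \<longleftrightarrow> z \<in> D" using mset [of xs] by simp
    qed
  qed
qed

section \<open>The Hopf map of a left bialgebroid\<close>

context left_bialgebroid
begin

text \<open>
  Scalars act through \<open>B\<close>, so balancedness over the ground field is a special case of balancedness
  over \<open>B\<close>.
\<close>

lemma scale_eq_src: "total_scale H c X = src H (base_scale H c 1) * X"
  and scale_eq_tgt: "total_scale H c X = tgt H (base_scale H c 1) * X"
  and scale_eq_right_tgt: "total_scale H c X = X * tgt H (base_scale H c 1)"
proof -
  have "src H (base_scale H c 1) = total_scale H c 1" "tgt H (base_scale H c 1) = total_scale H c 1"
  proof -
    interpret src: Vector_Spaces.linear "base_scale H" "total_scale H" "src H"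
      using src_hom by (simp add: algebra_map_def)
    interpret tgt: Vector_Spaces.linear "base_scale H" "total_scale H" "tgt H"
      using tgt_hom by (simp add: op_algebra_map_def)
    show "src H (base_scale H c 1) = total_scale H c 1" "tgt H (base_scale H c 1) = total_scale H c 1"
      using src_hom tgt_hom
      by (simp_all add: src.scale tgt.scale algebra_map_def op_algebra_map_def)
  qed
  then show "total_scale H c X = src H (base_scale H c 1) * X"
    "total_scale H c X = tgt H (base_scale H c 1) * X"
    "total_scale H c X = X * tgt H (base_scale H c 1)"
    by (simp_all add: total.scale_mult_left total.scale_mult_right)
qed

lemma tgt_mult: "tgt H (b * c) = tgt H c * tgt H b" and tgt_add: "tgt H (b + c) = tgt H b + tgt H c"
proof -
  interpret tgt: Vector_Spaces.linear "base_scale H" "total_scale H" "tgt H"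
    using tgt_hom by (simp add: op_algebra_map_def)
  show "tgt H (b * c) = tgt H c * tgt H b" "tgt H (b + c) = tgt H b + tgt H c"
    using tgt_hom by (simp_all add: op_algebra_map_def tgt.add)
qed

lemma src_one: "src H 1 = 1" and tgt_one: "tgt H 1 = 1"
  using src_hom tgt_hom by (simp_all add: algebra_map_def op_algebra_map_def)

lemma preserves_ldiamond:
  assumes inv: "\<And>x n. invertible_in \<sigma> (g (x, n))"
    and scale: "\<And>c n. kN c n = sN (base_scale H c 1) n"
    and l: "\<And>x x' n. tcong \<sigma> (g (x + x', n)) (g (x, n) + g (x', n))"
    and r: "\<And>x n n'. tcong \<sigma> (g (x, n + n')) (g (x, n) + g (x, n'))"
    and b: "\<And>b x n. tcong \<sigma> (g (tgt H b * x, n)) (g (x, sN b n))"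
  shows "preserves (ldiamond_rel H kN sN) \<sigma> g"
proof -
  have "preserves (tensor_rel UNIV (univ_module (total_scale H)) (univ_module kN)) \<sigma> g"
    by (rule preserves_tensor_univ)
      (simp_all add: inv l r scale scale_eq_tgt b)
  then show ?thesis unfolding preserves_def ldiamond_rel_def
    by (auto elim!: diamond_rel.cases intro: b)
qed

lemma tensor_ldiamond:
  "tensor_rel UNIV (univ_module (total_scale H)) (univ_module kN) \<subseteq> ldiamond_rel H kN sN"
  unfolding ldiamond_rel_def by (auto intro: diamond_rel.ground)

lemma group_ldiamond: "group_rel (ldiamond_rel H kN sN)"
  using group_tensor_univ tensor_ldiamond by (rule group_rel_mono)

lemma ldiamond_rules:
  shows "tcong (ldiamond_rel H kN sN) {#(x + x', n)#} ({#(x, n)#} + {#(x', n)#})"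
    and "tcong (ldiamond_rel H kN sN) {#(x, n + n')#} ({#(x, n)#} + {#(x, n')#})"
    and "tcong (ldiamond_rel H kN sN) {#(tgt H b * x, n)#} {#(x, sN b n)#}"
  subgoal using tcong_mono [OF tensor_univ_add_left tensor_ldiamond] by (rule tcong_sumI)
  subgoal using tcong_mono [OF tensor_univ_add_right tensor_ldiamond] by (rule tcong_sumI)
  subgoal unfolding ldiamond_rel_def by (intro tcong.base diamond_rel.balanced)
  done

lemma preserves_ldiamond3:
  assumes inv: "\<And>m n q. invertible_in \<sigma> (g (m, n, q))"
    and scale: "\<And>c n. kN c n = sN (base_scale H c 1) n"
    and add1: "\<And>m m' n q. tcong \<sigma> (g (m + m', n, q)) (g (m, n, q) + g (m', n, q))"
    and add2: "\<And>m n n' q. tcong \<sigma> (g (m, n + n', q)) (g (m, n, q) + g (m, n', q))"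
    and add3: "\<And>m n q q'. tcong \<sigma> (g (m, n, q + q')) (g (m, n, q) + g (m, n, q'))"
    and b12: "\<And>b m n q. tcong \<sigma> (g (tgt H b * m, n, q)) (g (m, src H b * n, q))"
    and b23: "\<And>b m n q. tcong \<sigma> (g (m, tgt H b * n, q)) (g (m, n, sN b q))"
  shows "preserves (ldiamond3_rel H kN sN) \<sigma> g"
proof -
  have "tcong \<sigma> (g (total_scale H c m, n, q)) (g (m, total_scale H c n, q))" for c m n q
    using b12 [of "base_scale H c 1" m n q]
    by (simp add: scale_eq_src [of c n] scale_eq_tgt [of c m])
  moreover have "tcong \<sigma> (g (m, total_scale H c n, q)) (g (m, n, kN c q))" for c m n q
    using b23 by (simp add: scale_eq_tgt scale)
  ultimately have "preserves (tensor3_rel (total_scale H) (total_scale H) kN) \<sigma> g"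
    by (intro preserves_tensor3) (simp_all add: inv add1 add2 add3)
  then show ?thesis unfolding preserves_def
    by (auto elim!: ldiamond3_rel.cases intro: b12 b23)
qed

lemma tensor3_ldiamond3:
  "tensor3_rel (total_scale H) (total_scale H) kN \<subseteq> ldiamond3_rel H kN sN"
  by (auto intro: ldiamond3_rel.ground)

lemma group_ldiamond3: "group_rel (ldiamond3_rel H kN sN)"
  using group_tensor3 tensor3_ldiamond3 by (rule group_rel_mono)

lemma ldiamond3_rules:
  shows "tcong (ldiamond3_rel H kN sN) {#(x + x', y, n)#} ({#(x, y, n)#} + {#(x', y, n)#})"
    and "tcong (ldiamond3_rel H kN sN) {#(x, y + y', n)#} ({#(x, y, n)#} + {#(x, y', n)#})"
    and "tcong (ldiamond3_rel H kN sN) {#(x, y, n + n')#} ({#(x, y, n)#} + {#(x, y, n')#})"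
    and "tcong (ldiamond3_rel H kN sN) {#(tgt H b * x, y, n)#} {#(x, src H b * y, n)#}"
    and "tcong (ldiamond3_rel H kN sN) {#(x, tgt H b * y, n)#} {#(x, y, sN b n)#}"
  subgoal using tcong_mono [OF tcong.base [OF tensor3_rel.add1] tensor3_ldiamond3] by (rule tcong_sumI)
  subgoal using tcong_mono [OF tcong.base [OF tensor3_rel.add2] tensor3_ldiamond3] by (rule tcong_sumI)
  subgoal using tcong_mono [OF tcong.base [OF tensor3_rel.add3] tensor3_ldiamond3] by (rule tcong_sumI)
  subgoal by (rule tcong.base [OF ldiamond3_rel.balanced12])
  subgoal by (rule tcong.base [OF ldiamond3_rel.balanced23])
  done

abbreviation \<delta> :: "'l \<Rightarrow> ('l \<times> 'l) multiset" where "\<delta> X \<equiv> rep (comul H X)"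

lemma rep_comul: "comul H X = tclass (LL_rel H) z \<Longrightarrow> tcong (LL_rel H) (\<delta> X) z"
  by (simp add: tcong_rep)

lemma preserves_LL:
  assumes "\<And>x n. invertible_in \<sigma> (g (x, n))"
    and "\<And>x x' n. tcong \<sigma> (g (x + x', n)) (g (x, n) + g (x', n))"
    and "\<And>x n n'. tcong \<sigma> (g (x, n + n')) (g (x, n) + g (x, n'))"
    and "\<And>b x n. tcong \<sigma> (g (tgt H b * x, n)) (g (x, src H b * n))"
  shows "preserves (LL_rel H) \<sigma> g"
  unfolding LL_rel_def by (rule preserves_ldiamond) (use assms scale_eq_src in auto)

lemmas LL_rules = ldiamond_rules [where kN = "total_scale H" and sN = "\<lambda>b X. src H b * X",
    folded LL_rel_def]
lemmas LL_invertible = group_ldiamond [where kN = "total_scale H" and sN = "\<lambda>b X. src H b * X",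
    folded LL_rel_def, THEN group_rel_invertible]

lemma rep_comul_add: "tcong (LL_rel H) (\<delta> (X + Y)) (\<delta> X + \<delta> Y)"
  by (intro rep_comul comul_add)

lemma LL_mult_preserves: "preserves (LL_rel H) (LL_rel H) (\<lambda>(x, y). {#(x * x', y * y')#})"
  by (rule preserves_LL)
    (auto simp: LL_invertible distrib_right mult.assoc intro: LL_rules [simplified])

lemma LL_tgt_preserves: "preserves (LL_rel H) (LL_rel H) (\<lambda>(x, y). {#(x, tgt H a * y)#})"
proof -
  have "tgt H a * (src H b * n) = src H b * (tgt H a * n)" for b n
    by (metis mult.assoc src_tgt_commute)
  then show ?thesis
    by (intro preserves_LL) (auto simp: LL_invertible distrib_left intro: LL_rules [simplified])
qed

lemma rep_comul_tgt_mult: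
  "tcong (LL_rel H) (\<delta> (tgt H b * X)) (lin (\<lambda>(x, y). {#(x, tgt H b * y)#}) (\<delta> X))"
  using rep_comul [OF comul_bimodule [of 1 b X]] by (simp add: src_one split_def lin_singletons)

text \<open>
  Replacing the representative of \<open>\<Delta>(t a)\<close> inside the product \<open>\<Delta>(X) \<Delta>(t a)\<close> is legitimate only because
  \<open>\<Delta>(X)\<close> lies in the Takeuchi product.
\<close>

lemma rep_comul_mult_tgt: "tcong (LL_rel H) (\<delta> (X * tgt H a)) (lin (\<lambda>(x, y). {#(x, y * tgt H a)#}) (\<delta> X))"
proof -
  have t: "tcong (LL_rel H) (lin (\<lambda>(x, y). {#(x * tgt H a, y)#}) (\<delta> X))
      (lin (\<lambda>(x, y). {#(x, y * src H a)#}) (\<delta> X))" for a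
  proof -
    obtain z where z: "comul H X = tclass (LL_rel H) z"
      "tcong (LL_rel H) (lin (\<lambda>(x, y). {#(x * tgt H a, y)#}) z) (lin (\<lambda>(x, y). {#(x, y * src H a)#}) z)"
      using comul_takeuchi [of X]
      by (auto simp: takeuchi_def tclass_eq_iff lin_singletons [symmetric] split_def)
    have "tcong (LL_rel H) (lin (\<lambda>(x, y). {#(x * tgt H a, y)#}) (\<delta> X)) (lin (\<lambda>(x, y). {#(x * tgt H a, y)#}) z)"
      using preserves_lin [OF LL_mult_preserves [of "tgt H a" 1] rep_comul [OF z(1)]] by simp
    also note z(2)
    also have "tcong (LL_rel H) (lin (\<lambda>(x, y). {#(x, y * src H a)#}) z) (lin (\<lambda>(x, y). {#(x, y * src H a)#}) (\<delta> X))"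
      using preserves_lin [OF LL_mult_preserves [of 1 "src H a"] tcong.sym [OF rep_comul [OF z(1)]]] by simp
    finally show ?thesis .
  qed
  \<comment> \<open>left multiplication by the comultiplication of \<open>X\<close>\<close>
  define M where "M = (\<lambda>(x', y'). lin (\<lambda>(x, y). {#(x * x', y * y')#}) (\<delta> X))"
  have M: "preserves (LL_rel H) (LL_rel H) M"
  proof (rule preserves_LL)
    fix b x n
    show "tcong (LL_rel H) (M (tgt H b * x, n)) (M (x, src H b * n))"
      using preserves_lin [OF LL_mult_preserves [of x n] t [of b]]
      by (simp add: M_def lin_lin split_def mult.assoc)
  qed (auto simp: M_def LL_invertible distrib_left intro!: tcong_lin_plus intro: LL_rules [simplified])
  have a: "tcong (LL_rel H) (\<delta> (tgt H a)) {#(1, tgt H a)#}"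
  proof -
    have "tcong (LL_rel H) (\<delta> (tgt H a * 1)) (lin (\<lambda>(x, y). {#(x, tgt H a * y)#}) (\<delta> 1))"
      by (rule rep_comul_tgt_mult)
    also have "tcong (LL_rel H) \<dots> (lin (\<lambda>(x, y). {#(x, tgt H a * y)#}) {#(1, 1)#})"
      using LL_tgt_preserves rep_comul [OF comul_one] by (rule preserves_lin)
    finally show ?thesis by simp
  qed
  have "tcong (LL_rel H) (\<delta> (X * tgt H a)) (lin M (\<delta> (tgt H a)))"
    using rep_comul [OF comul_mult [of X "tgt H a"]]
    by (subst (asm) mult_sum_swap) (simp add: M_def)
  also have "tcong (LL_rel H) \<dots> (lin M {#(1, tgt H a)#})"
    using M a by (rule preserves_lin)
  finally show ?thesis by (simp add: M_def)
qed

text \<open>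
  The Hopf map on pure tensors.
\<close>

definition hopf_sum :: "'l \<times> 'l \<Rightarrow> ('l \<times> 'l) multiset" where
  "hopf_sum = (\<lambda>(X, Y). lin (\<lambda>(x, x'). {#(x, x' * Y)#}) (\<delta> X))"

lemma LbarL_invertible: "invertible_in (LbarL_rel H) z"
  unfolding LbarL_rel_def using group_tensor_univ by (rule group_rel_invertible)

lemma LbarL_rules:
  shows "tcong (LbarL_rel H) {#(x + x', y)#} ({#(x, y)#} + {#(x', y)#})"
    and "tcong (LbarL_rel H) {#(x, y + y')#} ({#(x, y)#} + {#(x, y')#})"
    and "tcong (LbarL_rel H) {#(x * tgt H b, y)#} {#(x, tgt H b * y)#}"
  unfolding LbarL_rel_def
  subgoal by (rule tcong_sumI [OF tensor_univ_add_left])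
  subgoal by (rule tcong_sumI [OF tensor_univ_add_right])
  subgoal by (rule tensor_univ_balanced [OF UNIV_I])
  done

lemma hopf_sum_preserves: "preserves (LbarL_rel H) (LL_rel H) hopf_sum"
  unfolding LbarL_rel_def
proof (rule preserves_tensor_univ)
  fix X X' Y
  show "tcong (LL_rel H) (hopf_sum (X + X', Y)) (hopf_sum (X, Y) + hopf_sum (X', Y))"
    using preserves_lin [OF LL_mult_preserves [of 1 Y] rep_comul_add [of X X']] by (simp add: hopf_sum_def)
next
  fix b X Y
  show "tcong (LL_rel H) (hopf_sum (X * tgt H b, Y)) (hopf_sum (X, tgt H b * Y))"
    using preserves_lin [OF LL_mult_preserves [of 1 Y] rep_comul_mult_tgt [of X b]]
    by (simp add: hopf_sum_def lin_lin split_def mult.assoc)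
qed (auto simp: hopf_sum_def LL_invertible distrib_left intro!: tcong_lin_plus intro: LL_rules [simplified])

lemma hopf_map_tclass: "hopf_map H (tclass (LbarL_rel H) z) = tclass (LL_rel H) (lin hopf_sum z)"
proof -
  have "hopf_map H (tclass (LbarL_rel H) z) = tclass (LL_rel H) (lin hopf_sum (rep (tclass (LbarL_rel H) z)))"
    by (simp add: hopf_map_def hopf_sum_def lin_def [symmetric] lin_singletons split_def)
  then show ?thesis
    by (simp add: tclass_eq_iff preserves_lin [OF hopf_sum_preserves tcong_rep])
qed

text \<open>
  The Hopf map is linear for the action of \<open>b\<close> by left multiplication with its target image, on the first
  factor of the source and on the second factor of the codomain. This is the action over which \<open>P\<close> will
  be tensored.
\<close>

lemma hopf_sum_tgt:
  "tcong (LL_rel H) (hopf_sum (tgt H b * X, Y)) (lin (\<lambda>(x, y). {#(x, tgt H b * y)#}) (hopf_sum (X, Y)))"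
  using preserves_lin [OF LL_mult_preserves [of 1 Y] rep_comul_tgt_mult [of b X]]
  by (simp add: hopf_sum_def lin_lin split_def mult.assoc)

lemma LbarL_presented:
  "presented_module (LbarL_rel H) (\<lambda>z. encode (tclass (LbarL_rel H) z) :: ('b, 'l, 'p) test_universe)
     (\<lambda>b (X, Y). (tgt H b * X, Y))"
proof
  show "group_rel (LbarL_rel H)" unfolding LbarL_rel_def by (rule group_tensor_univ)
next
  fix b
  show "preserves (LbarL_rel H) (LbarL_rel H) (\<lambda>a. {#case a of (X, Y) \<Rightarrow> (tgt H b * X, Y)#})"
    unfolding LbarL_rel_def [of H, symmetric] using LbarL_rules
    by (subst LbarL_rel_def, intro preserves_tensor_univ)
      (auto simp: LbarL_invertible distrib_left mult.assoc [symmetric])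
next
  fix b c and a :: "'l \<times> 'l"
  show "tcong (LbarL_rel H) {#case a of (X, Y) \<Rightarrow> (tgt H (b + c) * X, Y)#}
      ({#case a of (X, Y) \<Rightarrow> (tgt H b * X, Y)#} + {#case a of (X, Y) \<Rightarrow> (tgt H c * X, Y)#})"
    by (cases a) (auto simp: tgt_add distrib_right intro: LbarL_rules [simplified])
qed (auto simp: inj_eq [OF inj_encode] tclass_eq_iff tgt_mult tgt_one mult.assoc)

lemma LL_presented:
  "presented_module (LL_rel H) (\<lambda>z. encode (tclass (LL_rel H) z) :: ('b, 'l, 'p) test_universe)
     (\<lambda>b (X, Y). (X, tgt H b * Y))"
proof
  show "group_rel (LL_rel H)" unfolding LL_rel_def by (rule group_ldiamond)
next
  fix b
  show "preserves (LL_rel H) (LL_rel H) (\<lambda>a. {#case a of (X, Y) \<Rightarrow> (X, tgt H b * Y)#})"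
    using LL_tgt_preserves by (simp add: split_def)
next
  fix b c and a :: "'l \<times> 'l"
  show "tcong (LL_rel H) {#case a of (X, Y) \<Rightarrow> (X, tgt H (b + c) * Y)#}
      ({#case a of (X, Y) \<Rightarrow> (X, tgt H b * Y)#} + {#case a of (X, Y) \<Rightarrow> (X, tgt H c * Y)#})"
    by (cases a) (auto simp: tgt_add distrib_right intro: LL_rules [simplified])
qed (auto simp: inj_eq [OF inj_encode] tclass_eq_iff tgt_mult tgt_one mult.assoc)

end

section \<open>Comodule algebras\<close>

context left_comodule_algebra
begin

abbreviation LP where "LP \<equiv> LP_rel H A"
abbreviation LLP where "LLP \<equiv> LLP_rel H A"
abbreviation LL_P where "LL_P \<equiv> ldiamond3_rel H (ring_scale A) (\<lambda>b p. str A b * p)"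
abbreviation PP where "PP \<equiv> PNP_rel H A"
abbreviation \<kappa> :: "'p \<Rightarrow> ('l \<times> 'p) multiset" where "\<kappa> p \<equiv> rep (coaction A p)"

lemma scale_eq_str: "ring_scale A c p = str A (base_scale H c 1) * p"
proof -
  interpret str: Vector_Spaces.linear "base_scale H" "ring_scale A" "str A"
    using str_hom by (simp add: algebra_map_def)
  show ?thesis
    using str_hom by (simp add: str.scale algebra_map_def P.scale_mult_left)
qed

lemma preserves_LP:
  assumes "\<And>x n. invertible_in \<sigma> (g (x, n))"
    and "\<And>x x' n. tcong \<sigma> (g (x + x', n)) (g (x, n) + g (x', n))"
    and "\<And>x n n'. tcong \<sigma> (g (x, n + n')) (g (x, n) + g (x, n'))"
    and "\<And>b x n. tcong \<sigma> (g (tgt H b * x, n)) (g (x, str A b * n))"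
  shows "preserves LP \<sigma> g"
  unfolding LP_rel_def by (rule preserves_ldiamond) (use assms scale_eq_str in auto)

lemmas LP_rules = ldiamond_rules [where kN = "ring_scale A" and sN = "\<lambda>b p. str A b * p",
    folded LP_rel_def]
lemmas LP_invertible = group_ldiamond [where kN = "ring_scale A" and sN = "\<lambda>b p. str A b * p",
    folded LP_rel_def, THEN group_rel_invertible]

lemma preserves_LL_P:
  assumes "\<And>m n q. invertible_in \<sigma> (g (m, n, q))"
    and "\<And>m m' n q. tcong \<sigma> (g (m + m', n, q)) (g (m, n, q) + g (m', n, q))"
    and "\<And>m n n' q. tcong \<sigma> (g (m, n + n', q)) (g (m, n, q) + g (m, n', q))"
    and "\<And>m n q q'. tcong \<sigma> (g (m, n, q + q')) (g (m, n, q) + g (m, n, q'))"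
    and "\<And>b m n q. tcong \<sigma> (g (tgt H b * m, n, q)) (g (m, src H b * n, q))"
    and "\<And>b m n q. tcong \<sigma> (g (m, tgt H b * n, q)) (g (m, n, str A b * q))"
  shows "preserves LL_P \<sigma> g"
  by (rule preserves_ldiamond3) (use assms scale_eq_str in auto)

lemmas LL_P_rules = ldiamond3_rules [where kN = "ring_scale A" and sN = "\<lambda>b p. str A b * p"]
lemmas LL_P_invertible = group_ldiamond3 [where kN = "ring_scale A" and sN = "\<lambda>b p. str A b * p", THEN group_rel_invertible]

lemma preserves_LLP:
  assumes inv: "\<And>m n q. invertible_in \<sigma> (g (m, n, q))"
    and add1: "\<And>m m' n q. tcong \<sigma> (g (m + m', n, q)) (g (m, n, q) + g (m', n, q))"
    and add2: "\<And>m n n' q. tcong \<sigma> (g (m, n + n', q)) (g (m, n, q) + g (m, n', q))"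
    and add3: "\<And>m n q q'. tcong \<sigma> (g (m, n, q + q')) (g (m, n, q) + g (m, n, q'))"
    and b12: "\<And>b m n q. tcong \<sigma> (g (m * tgt H b, n, q)) (g (m, tgt H b * n, q))"
    and b13: "\<And>b m n q. tcong \<sigma> (g (tgt H b * m, n, q)) (g (m, n, str A b * q))"
  shows "preserves LLP \<sigma> g"
proof -
  have 12: "tcong \<sigma> (g (total_scale H c m, n, q)) (g (m, total_scale H c n, q))" for c m n q
    using b12 [of m "base_scale H c 1" n q]
    by (simp add: scale_eq_right_tgt [of c m] scale_eq_tgt [of c n])
  have 13: "tcong \<sigma> (g (total_scale H c m, n, q)) (g (m, n, ring_scale A c q))" for c m n q
    using b13 by (simp add: scale_eq_tgt scale_eq_str)
  have "preserves (tensor3_rel (total_scale H) (total_scale H) (ring_scale A)) \<sigma> g"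
    by (intro preserves_tensor3 12 tcong.trans [OF tcong.sym [OF 12] 13])
      (simp_all add: inv add1 add2 add3)
  then show ?thesis unfolding preserves_def
    by (auto elim!: LLP_rel.cases intro: b12 b13)
qed

lemma tensor3_LLP: "tensor3_rel (total_scale H) (total_scale H) (ring_scale A) \<subseteq> LLP"
  by (auto intro: LLP_rel.ground)

lemma LLP_invertible: "invertible_in LLP z"
  using group_rel_mono [OF group_tensor3 tensor3_LLP] by (rule group_rel_invertible)

lemma LLP_rules:
  shows "tcong LLP {#(x + x', y, n)#} ({#(x, y, n)#} + {#(x', y, n)#})"
    and "tcong LLP {#(x, y + y', n)#} ({#(x, y, n)#} + {#(x, y', n)#})"
    and "tcong LLP {#(x, y, n + n')#} ({#(x, y, n)#} + {#(x, y, n')#})"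
    and LLP_balanced12: "tcong LLP {#(x * tgt H b, y, n)#} {#(x, tgt H b * y, n)#}"
    and "tcong LLP {#(tgt H b * x, y, n)#} {#(x, y, str A b * n)#}"
  subgoal using tcong_mono [OF tcong.base [OF tensor3_rel.add1] tensor3_LLP] by (rule tcong_sumI)
  subgoal using tcong_mono [OF tcong.base [OF tensor3_rel.add2] tensor3_LLP] by (rule tcong_sumI)
  subgoal using tcong_mono [OF tcong.base [OF tensor3_rel.add3] tensor3_LLP] by (rule tcong_sumI)
  subgoal by (rule tcong.base [OF LLP_rel.balanced12])
  subgoal by (rule tcong.base [OF LLP_rel.balanced13])
  done

lemma preserves_PP:
  assumes "\<And>p q. invertible_in \<sigma> (g (p, q))"
    and "\<And>p p' q. tcong \<sigma> (g (p + p', q)) (g (p, q) + g (p', q))"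
    and "\<And>p q q'. tcong \<sigma> (g (p, q + q')) (g (p, q) + g (p, q'))"
    and "\<And>n p q. n \<in> coinvariants H A \<Longrightarrow> tcong \<sigma> (g (p * n, q)) (g (p, n * q))"
  shows "preserves PP \<sigma> g"
  unfolding PNP_rel_def
  by (rule preserves_tensor_univ) (use assms in auto)

lemma rep_coaction: "coaction A p = tclass LP z \<Longrightarrow> tcong LP (\<kappa> p) z"
  by (simp add: tcong_rep)

lemma rep_coaction_add: "tcong LP (\<kappa> (p + q)) (\<kappa> p + \<kappa> q)"
  using left_comodule.coact_add [OF comodule, of p q] unfolding LP_rel_def [symmetric]
  by (rule rep_coaction)

lemma rep_coaction_mult: "tcong LP (\<kappa> (p * q)) (mult_sum (\<kappa> p) (\<kappa> q))"
  using coaction_mult by (rule rep_coaction)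

lemma rep_coaction_one: "tcong LP (\<kappa> 1) {#(1, 1)#}"
  using coaction_one by (rule rep_coaction)

lemma str_one: "str A 1 = 1"
  using str_hom by (simp add: algebra_map_def)

lemma rep_coaction_bimodule:
  "tcong LP (\<kappa> (str A b * (p * str A c))) (lin (\<lambda>(x, p'). {#(src H b * x * src H c, p')#}) (\<kappa> p))"
  using left_comodule.coact_bimodule [OF comodule, of b p c] unfolding LP_rel_def [symmetric]
  by (intro rep_coaction) (simp add: split_def lin_singletons)

lemma rep_coaction_left: "tcong LP (\<kappa> (str A b * p)) (lin (\<lambda>(x, p'). {#(src H b * x, p')#}) (\<kappa> p))"
  and rep_coaction_right: "tcong LP (\<kappa> (p * str A b)) (lin (\<lambda>(x, p'). {#(x * src H b, p')#}) (\<kappa> p))"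
  using rep_coaction_bimodule [of b p 1] rep_coaction_bimodule [of 1 p b] by (simp_all add: str_one src_one)

lemma LP_mult_right: "preserves LP LP (\<lambda>(x, p). {#(x * y, p * q)#})"
  by (rule preserves_LP)
    (auto simp: LP_invertible distrib_right mult.assoc intro: LP_rules [simplified])

text \<open>
  The Takeuchi condition is stated for some representative of the coaction; it passes to the chosen
  one because both sides are well defined on classes.
\<close>

lemma rep_coaction_takeuchi:
  "tcong LP (lin (\<lambda>(x, p). {#(x * tgt H a, p)#}) (\<kappa> p)) (lin (\<lambda>(x, p). {#(x, p * str A a)#}) (\<kappa> p))"
proof -
  obtain z where z: "coaction A p = tclass LP z"
    "tcong LP (lin (\<lambda>(x, p). {#(x * tgt H a, p)#}) z) (lin (\<lambda>(x, p). {#(x, p * str A a)#}) z)"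
    using left_comodule.coact_takeuchi [OF comodule, of p] unfolding LP_rel_def [symmetric]
    by (auto simp: takeuchi_def tclass_eq_iff lin_singletons split_def)
  have "tcong LP (lin (\<lambda>(x, p). {#(x * tgt H a, p)#}) (\<kappa> p)) (lin (\<lambda>(x, p). {#(x * tgt H a, p)#}) z)"
    using preserves_lin [OF LP_mult_right [of "tgt H a" 1] rep_coaction [OF z(1)]] by simp
  also note z(2)
  also have "tcong LP (lin (\<lambda>(x, p). {#(x, p * str A a)#}) z) (lin (\<lambda>(x, p). {#(x, p * str A a)#}) (\<kappa> p))"
    using preserves_lin [OF LP_mult_right [of 1 "str A a"] tcong.sym [OF rep_coaction [OF z(1)]]]
    by simp
  finally show ?thesis .
qed

lemma rep_coaction_coassoc:
  "tcong LL_P (lin (\<lambda>(x, p'). lin (\<lambda>(u, v). {#(u, v, p')#}) (\<delta> x)) (\<kappa> p))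
     (lin (\<lambda>(x, p'). lin (\<lambda>(u, v). {#(x, u, v)#}) (\<kappa> p')) (\<kappa> p))"
  using left_comodule.coact_coassociative [OF comodule, of p]
  by (simp add: tclass_eq_iff lin_def [symmetric] split_def lin_singletons)

lemma
  assumes "n \<in> coinvariants H A"
  shows rep_coaction_coinvariant_right: "tcong LP (\<kappa> (p * n)) (lin (\<lambda>(x, p'). {#(x, p' * n)#}) (\<kappa> p))"
    and rep_coaction_coinvariant_left: "tcong LP (\<kappa> (n * p)) (lin (\<lambda>(x, p'). {#(x, n * p')#}) (\<kappa> p))"
proof -
  have n: "tcong LP (\<kappa> n) {#(1, n)#}"
    using assms by (intro rep_coaction) (simp add: coinvariants_def)
  \<comment> \<open>left multiplication by the coaction of \<open>p\<close>\<close>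
  define M where "M = (\<lambda>(x', q). lin (\<lambda>(x, p'). {#(x * x', p' * q)#}) (\<kappa> p))"
  have M: "preserves LP LP M"
  proof (rule preserves_LP)
    fix b x q
    show "tcong LP (M (tgt H b * x, q)) (M (x, str A b * q))"
      using preserves_lin [OF LP_mult_right [of x q] rep_coaction_takeuchi [of b p]]
      by (simp add: M_def lin_lin split_def mult.assoc)
  qed (auto simp: M_def LP_invertible distrib_left intro!: tcong_lin_plus intro: LP_rules [simplified])
  have "tcong LP (\<kappa> (p * n)) (lin M (\<kappa> n))"
    using rep_coaction_mult [of p n] by (subst (asm) mult_sum_swap) (simp add: M_def)
  also have "tcong LP \<dots> (lin M {#(1, n)#})" using M n by (rule preserves_lin)
  finally show "tcong LP (\<kappa> (p * n)) (lin (\<lambda>(x, p'). {#(x, p' * n)#}) (\<kappa> p))"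
    by (simp add: M_def)
  \<comment> \<open>right multiplication by the coaction of \<open>p\<close>\<close>
  define M' where "M' = (\<lambda>(x, q). lin (\<lambda>(x', p'). {#(x * x', q * p')#}) (\<kappa> p))"
  have M': "preserves LP LP M'"
    by (rule preserves_LP)
     (auto simp: M'_def LP_invertible distrib_right mult.assoc intro!: tcong_lin_plus tcong_lin intro: LP_rules [simplified])
  have "tcong LP (\<kappa> (n * p)) (lin M' (\<kappa> n))"
    using rep_coaction_mult [of n p] by (subst (asm) mult_sum_lin) (simp add: M'_def)
  also have "tcong LP \<dots> (lin M' {#(1, n)#})" using M' n by (rule preserves_lin)
  finally show "tcong LP (\<kappa> (n * p)) (lin (\<lambda>(x, p'). {#(x, n * p')#}) (\<kappa> p))"
    by (simp add: M'_def)
qed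

text \<open>
  Right multiplication in the last two factors; it acts on both threefold products and commutes with
  \<open>\<Lambda>\<close>, which multiplies these factors from the left only.
\<close>

definition scale_triple :: "'l \<Rightarrow> 'p \<Rightarrow> 'l \<times> 'l \<times> 'p \<Rightarrow> ('l \<times> 'l \<times> 'p) multiset" where
  "scale_triple y r = (\<lambda>(a, b, c). {#(a, b * y, c * r)#})"

lemma scale_triple_LLP: "preserves LLP LLP (scale_triple y r)"
  unfolding scale_triple_def
  by (rule preserves_LLP)
    (auto simp: LLP_invertible distrib_right mult.assoc intro: LLP_rules [simplified])

lemma scale_triple_LL_P: "preserves LL_P LL_P (scale_triple y r)"
  unfolding scale_triple_def
  by (rule preserves_LL_P)
    (auto simp: LL_P_invertible distrib_right mult.assoc intro: LL_P_rules [simplified])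

definition can_sum :: "'p \<times> 'p \<Rightarrow> ('l \<times> 'p) multiset" where
  "can_sum = (\<lambda>(p, q). lin (\<lambda>(x, p'). {#(x, p' * q)#}) (\<kappa> p))"

lemma can_sum_preserves: "preserves PP LP can_sum"
proof (rule preserves_PP)
  fix n p q assume "n \<in> coinvariants H A"
  from preserves_lin [OF LP_mult_right [of 1 q] rep_coaction_coinvariant_right [OF this, of p]]
  show "tcong LP (can_sum (p * n, q)) (can_sum (p, n * q))"
    by (simp add: can_sum_def lin_lin split_def mult.assoc)
next
  fix p p' q
  from preserves_lin [OF LP_mult_right [of 1 q] rep_coaction_add [of p p']]
  show "tcong LP (can_sum (p + p', q)) (can_sum (p, q) + can_sum (p', q))"
    by (simp add: can_sum_def)
qed (auto simp: can_sum_def LP_invertible distrib_left intro!: tcong_lin_plus intro: LP_rules [simplified])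

lemma can_tclass: "can H A (tclass PP z) = tclass LP (lin can_sum z)"
proof -
  have "can H A (tclass PP z) = tclass LP (lin can_sum (rep (tclass PP z)))"
    by (simp add: can_def can_sum_def lin_def [symmetric] lin_singletons split_def)
  then show ?thesis
    by (simp add: tclass_eq_iff preserves_lin [OF can_sum_preserves tcong_rep])
qed

text \<open>
  The map \<open>Z \<otimes> q \<mapsto> p\<^sub>-\<^sub>1 \<otimes> Z \<otimes> p\<^sub>0 q\<close>. It respects \<open>\<L> \<diamondop> P\<close> by the Takeuchi condition for \<open>p\<close>: \<open>p\<^sub>0 b\<close> can be
  traded for \<open>p\<^sub>-\<^sub>1\<close> times the target image of \<open>b\<close>.
\<close>

definition coact_left :: "'p \<Rightarrow> 'l \<times> 'p \<Rightarrow> ('l \<times> 'l \<times> 'p) multiset" where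
  "coact_left p = (\<lambda>(z, q). lin (\<lambda>(y, p'). {#(y, z, p' * q)#}) (\<kappa> p))"

lemma coact_left_preserves: "preserves LP LLP (coact_left p)"
proof (rule preserves_LP)
  fix b x n
  have "preserves LP LLP (\<lambda>(y, p'). {#(y, x, p' * n)#})"
    by (rule preserves_LP)
      (auto simp: LLP_invertible distrib_right mult.assoc intro: LLP_rules [simplified])
  from preserves_lin [OF this rep_coaction_takeuchi [of b p]]
  have "tcong LLP (lin (\<lambda>(y, p'). {#(y * tgt H b, x, p' * n)#}) (\<kappa> p)) (coact_left p (x, str A b * n))"
    by (simp add: lin_lin split_def coact_left_def mult.assoc)
  moreover have "tcong LLP (coact_left p (tgt H b * x, n)) (lin (\<lambda>(y, p'). {#(y * tgt H b, x, p' * n)#}) (\<kappa> p))"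
    unfolding coact_left_def by (auto intro!: tcong_lin tcong.sym [OF LLP_balanced12])
  ultimately show "tcong LLP (coact_left p (tgt H b * x, n)) (coact_left p (x, str A b * n))"
    using tcong.trans by blast
qed (auto simp: coact_left_def LLP_invertible distrib_left intro!: tcong_lin_plus intro: LLP_rules [simplified])

text \<open>
  The map \<open>p \<otimes> q \<mapsto> p\<^sub>-\<^sub>1 \<otimes> q\<^sub>-\<^sub>1 \<otimes> p\<^sub>0 q\<^sub>0\<close>; with \<open>X' \<otimes> X''\<close> for \<open>p \<otimes> q\<close> it gives the right-hand side of the formula
  for \<open>X\<^sub>+ \<otimes> X\<^sub>- \<otimes> 1\<close>.
\<close>

definition double_coact :: "'p \<times> 'p \<Rightarrow> ('l \<times> 'l \<times> 'p) multiset" where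
  "double_coact = (\<lambda>(p, q). lin (coact_left p) (\<kappa> q))"

text \<open>
  Both orders of summation are needed: this one to change the representative of the coaction of \<open>p\<close>, the
  defining one for that of \<open>q\<close>.
\<close>

lemma double_coact_alt:
  "double_coact (p, q) = lin (\<lambda>(y, p'). lin (\<lambda>(z, q'). {#(y, z, p' * q')#}) (\<kappa> q)) (\<kappa> p)"
  unfolding double_coact_def coact_left_def split_def prod.sel by (rule lin_swap)

lemma double_coact_preserves: "preserves PP LLP double_coact"
proof (rule preserves_PP)
  have *: "preserves LP LLP (\<lambda>(y, p'). lin (\<lambda>(z, q'). {#(y, z, p' * q')#}) (\<kappa> q))" for q
    by (rule preserves_LP)
      (auto simp: LLP_invertible distrib_right mult.assoc intro!: tcong_lin_plus tcong_lin intro: LLP_rules [simplified])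
  {
    fix p p' q
    show "tcong LLP (double_coact (p + p', q)) (double_coact (p, q) + double_coact (p', q))"
      using preserves_lin [OF * rep_coaction_add] by (simp add: double_coact_alt)
  next
    fix n p q assume n: "n \<in> coinvariants H A"
    have "tcong LLP (double_coact (p * n, q))
        (lin (\<lambda>(y, p'). lin (\<lambda>(z, q'). {#(y, z, p' * n * q')#}) (\<kappa> q)) (\<kappa> p))"
      using preserves_lin [OF * rep_coaction_coinvariant_right [OF n]]
      by (simp add: double_coact_alt lin_lin split_def)
    also have "\<dots> = lin (coact_left p) (lin (\<lambda>(x, p'). {#(x, n * p')#}) (\<kappa> q))"
      unfolding lin_lin coact_left_def split_def
      by (subst lin_swap) (simp add: mult.assoc)
    also have "tcong LLP \<dots> (double_coact (p, n * q))"
      using preserves_lin [OF coact_left_preserves tcong.sym [OF rep_coaction_coinvariant_left [OF n]]]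
      by (simp add: double_coact_def)
    finally show "tcong LLP (double_coact (p * n, q)) (double_coact (p, n * q))" .
  next
    fix p q q'
    show "tcong LLP (double_coact (p, q + q')) (double_coact (p, q) + double_coact (p, q'))"
      using preserves_lin [OF coact_left_preserves rep_coaction_add] by (simp add: double_coact_def)
  }
qed (rule LLP_invertible)

text \<open>
  The Hopf map tensored with \<open>P\<close>, called \<open>\<Lambda>\<close> above.
\<close>

definition hopf_triple :: "'l \<times> 'l \<times> 'p \<Rightarrow> ('l \<times> 'l \<times> 'p) multiset" where
  "hopf_triple = (\<lambda>(x, y, p). lin (\<lambda>(u, v). {#(u, v * y, p)#}) (\<delta> x))"

definition coact_right :: "'l \<times> 'p \<Rightarrow> ('l \<times> 'l \<times> 'p) multiset" where
  "coact_right = (\<lambda>(x, p). lin (\<lambda>(y, p'). {#(x, y, p')#}) (\<kappa> p))"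

lemma coact_right_preserves: "preserves LP LL_P coact_right"
proof (rule preserves_LP)
  have *: "preserves LP LL_P (\<lambda>(y, p'). {#(x, y, p')#})" for x
    by (rule preserves_LP) (auto simp: LL_P_invertible intro: LL_P_rules [simplified])
  {
    fix x n n'
    show "tcong LL_P (coact_right (x, n + n')) (coact_right (x, n) + coact_right (x, n'))"
      using preserves_lin [OF * rep_coaction_add] by (simp add: coact_right_def)
  next
    fix b x n
    have "tcong LL_P (coact_right (tgt H b * x, n)) (lin (\<lambda>(y, p'). {#(x, src H b * y, p')#}) (\<kappa> n))"
      by (auto simp: coact_right_def intro!: tcong_lin LL_P_rules)
    also have "tcong LL_P \<dots> (coact_right (x, str A b * n))"
      using preserves_lin [OF * tcong.sym [OF rep_coaction_left [of b n]]]
      by (simp add: coact_right_def lin_lin split_def)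
    finally show "tcong LL_P (coact_right (tgt H b * x, n)) (coact_right (x, str A b * n))" .
  }
qed (auto simp: coact_right_def LL_P_invertible intro!: tcong_lin_plus intro: LL_P_rules [simplified])

lemma LL_to_LL_P: "preserves (LL_rel H) LL_P (\<lambda>(u, v). {#(u, v * y, p)#})"
  by (rule preserves_LL)
    (auto simp: LL_P_invertible distrib_right mult.assoc intro: LL_P_rules [simplified])

lemma hopf_triple_preserves: "preserves LLP LL_P hopf_triple"
proof (rule preserves_LLP)
  fix b m n q
  show "tcong LL_P (hopf_triple (m * tgt H b, n, q)) (hopf_triple (m, tgt H b * n, q))"
    using preserves_lin [OF LL_to_LL_P rep_comul_mult_tgt]
    by (simp add: hopf_triple_def lin_lin split_def mult.assoc)
next
  fix b m n q
  from preserves_lin [OF LL_to_LL_P rep_comul_tgt_mult, of n q b m]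
  have "tcong LL_P (hopf_triple (tgt H b * m, n, q)) (lin (\<lambda>(u, v). {#(u, tgt H b * (v * n), q)#}) (\<delta> m))"
    by (simp add: hopf_triple_def lin_lin split_def mult.assoc)
  also have "tcong LL_P \<dots> (hopf_triple (m, n, str A b * q))"
    by (auto simp: hopf_triple_def intro!: tcong_lin LL_P_rules)
  finally show "tcong LL_P (hopf_triple (tgt H b * m, n, q)) (hopf_triple (m, n, str A b * q))" .
next
  fix m m' n q
  show "tcong LL_P (hopf_triple (m + m', n, q)) (hopf_triple (m, n, q) + hopf_triple (m', n, q))"
    using preserves_lin [OF LL_to_LL_P rep_comul_add] by (simp add: hopf_triple_def)
qed (auto simp: hopf_triple_def LL_P_invertible distrib_left intro!: tcong_lin_plus intro: LL_P_rules [simplified])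

text \<open>
  The compatibility at the heart of the proof: \<open>\<Lambda>\<close> turns the double coaction of \<open>p \<otimes> q\<close> into the coaction of the
  second factor of the Galois map at \<open>p \<otimes> q\<close>.
\<close>

lemma hopf_double_coact:
  "tcong LL_P (lin hopf_triple (double_coact (p, q))) (lin coact_right (can_sum (p, q)))"
proof -
  \<comment> \<open>right multiplication of the last two factors by the coaction of \<open>q\<close>, to be applied to both sides of coassociativity\<close>
  define M where "M = (\<lambda>(x :: 'l, y, p'). lin (\<lambda>(z, q'). {#(x, y * z, p' * q')#}) (\<kappa> q))"
  have M: "preserves LL_P LL_P M"
    by (rule preserves_LL_P)
      (auto simp: M_def LL_P_invertible distrib_right mult.assoc intro!: tcong_lin_plus tcong_lin intro: LL_P_rules [simplified])
  have *: "preserves LP LL_P (\<lambda>(y, p'). {#(x, y, p')#})" for x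
    by (rule preserves_LP) (auto simp: LL_P_invertible intro: LL_P_rules [simplified])
  have "lin hopf_triple (double_coact (p, q)) =
      lin M (lin (\<lambda>(x, p'). lin (\<lambda>(u, v). {#(u, v, p')#}) (\<delta> x)) (\<kappa> p))"
    unfolding double_coact_alt lin_lin hopf_triple_def M_def split_def
    by (intro lin_cong) (simp add: lin_lin, rule lin_swap)
  also have "tcong LL_P \<dots> (lin M (lin (\<lambda>(x, p'). lin (\<lambda>(u, v). {#(x, u, v)#}) (\<kappa> p')) (\<kappa> p)))"
    using M rep_coaction_coassoc by (rule preserves_lin)
  also have "\<dots> = lin (\<lambda>(x, p'). lin (\<lambda>(y, p''). {#(x, y, p'')#}) (mult_sum (\<kappa> p') (\<kappa> q))) (\<kappa> p)"
    unfolding mult_sum_lin lin_lin M_def split_def by (simp add: lin_lin)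
  also have "tcong LL_P \<dots> (lin (\<lambda>(x, p'). lin (\<lambda>(y, p''). {#(x, y, p'')#}) (\<kappa> (p' * q))) (\<kappa> p))"
    by (auto intro!: tcong_lin preserves_lin [OF *] tcong.sym [OF rep_coaction_mult])
  also have "\<dots> = lin coact_right (can_sum (p, q))"
    by (simp add: can_sum_def coact_right_def lin_lin split_def)
  finally show ?thesis .
qed

end

section \<open>The inverse built from the translation map\<close>

locale left_galois_extension = left_comodule_algebra H A
  for H :: "('k::field, 'b::{ring,monoid_mult}, 'l::{ring,monoid_mult}) bialgebroid"
    and A :: "('k, 'b, 'l, 'p::{ring,monoid_mult}) coacted_ring" +
  assumes can_bij: "bij_betw (can H A) (quot (PNP_rel H A)) (quot (LP_rel H A))"
begin

abbreviation \<tau> :: "'l \<Rightarrow> ('p \<times> 'p) multiset" where "\<tau> X \<equiv> rep (translation H A X)"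

lemma can_inject:
  assumes "tcong LP (lin can_sum z) (lin can_sum w)"
  shows "tcong PP z w"
proof -
  have "can H A (tclass PP z) = can H A (tclass PP w)"
    using assms by (simp add: can_tclass tclass_eq_iff)
  then have "tclass PP z = tclass PP w"
    using can_bij by (auto simp: bij_betw_def quot_def dest: inj_onD)
  then show ?thesis by (simp add: tclass_eq_iff)
qed

lemma can_translation: "tcong LP (lin can_sum (\<tau> X)) {#(X, 1)#}"
proof -
  have "tclass LP {#(X, 1)#} \<in> can H A ` quot PP"
    using can_bij by (simp add: bij_betw_def quot_def)
  then have "translation H A X \<in> quot PP" "can H A (translation H A X) = tclass LP {#(X, 1)#}"
    by (simp_all add: translation_def inv_into_into f_inv_into_f)
  then show ?thesis
    using can_tclass [of "\<tau> X"] by (simp add: tclass_rep tclass_eq_iff tcong.sym)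
qed

lemma can_sum_mult_right:
  "lin can_sum (lin (\<lambda>(p, q). {#(p, q * r)#}) z) = lin (\<lambda>(x, p). {#(x, p * r)#}) (lin can_sum z)"
  by (simp add: can_sum_def lin_lin split_def mult.assoc)

text \<open>
  The Galois map is right \<open>P\<close>-linear, so the translation map inverts it on all of \<open>\<L> \<diamondop> P\<close>: the inverse
  image of \<open>X \<otimes> r\<close> is \<open>X' \<otimes> X'' r\<close>.
\<close>

lemma can_translation_mult: "tcong LP (lin can_sum (lin (\<lambda>(p, q). {#(p, q * r)#}) (\<tau> X))) {#(X, r)#}"
  unfolding can_sum_mult_right
  using preserves_lin [OF LP_mult_right [of 1 r] can_translation [of X]] by simp

lemma translation_add: "tcong PP (\<tau> (X + Y)) (\<tau> X + \<tau> Y)"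
proof (rule can_inject)
  have "tcong LP (lin can_sum (\<tau> (X + Y))) {#(X + Y, 1)#}" by (rule can_translation)
  also have "tcong LP \<dots> ({#(X, 1)#} + {#(Y, 1)#})" by (rule LP_rules)
  also have "tcong LP \<dots> (lin can_sum (\<tau> X) + lin can_sum (\<tau> Y))"
    by (intro tcong.add tcong.sym [OF can_translation])
  finally show "tcong LP (lin can_sum (\<tau> (X + Y))) (lin can_sum (\<tau> X + \<tau> Y))" by simp
qed

text \<open>
  Both sides have the image \<open>X \<otimes> b\<close> under the Galois map.
\<close>

lemma translation_tgt: "tcong PP (\<tau> (tgt H b * X)) (lin (\<lambda>(p, q). {#(p, q * str A b)#}) (\<tau> X))"
proof (rule can_inject)
  have "tcong LP (lin can_sum (\<tau> (tgt H b * X))) {#(tgt H b * X, 1)#}" by (rule can_translation)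
  also have "tcong LP \<dots> {#(X, str A b)#}" using LP_rules(3) [of b X 1] by simp
  also note tcong.sym [OF can_translation_mult]
  finally show "tcong LP (lin can_sum (\<tau> (tgt H b * X)))
      (lin can_sum (lin (\<lambda>(p, q). {#(p, q * str A b)#}) (\<tau> X)))" .
qed

definition hopf_triple_inv :: "'l \<times> 'l \<times> 'p \<Rightarrow> ('l \<times> 'l \<times> 'p) multiset" where
  "hopf_triple_inv = (\<lambda>(x, y, r). lin (scale_triple y r) (lin double_coact (\<tau> x)))"

lemma double_coact_mult_base:
  "tcong LLP (double_coact (p, q * str A b)) (lin (scale_triple (src H b) 1) (double_coact (p, q)))"
  using preserves_lin [OF coact_left_preserves rep_coaction_right, of p q b]
  by (simp add: double_coact_def coact_left_def scale_triple_def lin_lin split_def)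

lemma double_coact_takeuchi:
  "tcong LLP (lin (scale_triple (tgt H b) 1) (double_coact (p, q))) (lin (scale_triple 1 (str A b)) (double_coact (p, q)))"
  using preserves_lin [OF coact_left_preserves rep_coaction_takeuchi, of p b q]
  by (simp add: double_coact_def coact_left_def scale_triple_def lin_lin split_def mult.assoc)

lemma scale_triple_scale_triple:
  "lin (scale_triple y r) (scale_triple y' r' t) = scale_triple (y' * y) (r' * r) t"
  by (simp add: scale_triple_def split_def mult.assoc)

text \<open>
  The relation that balances the first two factors reduces to \<open>translation_tgt\<close>, the one that
  balances the last two to the Takeuchi condition for the second factor of the translation map.
\<close>

lemma hopf_triple_inv_preserves: "preserves LL_P LLP hopf_triple_inv"
proof (rule preserves_LL_P)
  fix m m' n q
  show "tcong LLP (hopf_triple_inv (m + m', n, q)) (hopf_triple_inv (m, n, q) + hopf_triple_inv (m', n, q))"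
    using preserves_lin [OF scale_triple_LLP preserves_lin [OF double_coact_preserves translation_add]]
    by (simp add: hopf_triple_inv_def)
next
  fix b m n q
  have "tcong LLP (lin double_coact (\<tau> (tgt H b * m)))
      (lin (\<lambda>(p, q). double_coact (p, q * str A b)) (\<tau> m))"
    using preserves_lin [OF double_coact_preserves translation_tgt]
    by (simp add: lin_lin split_def)
  also have "tcong LLP \<dots> (lin (scale_triple (src H b) 1) (lin double_coact (\<tau> m)))"
    unfolding lin_lin by (auto intro!: tcong_lin double_coact_mult_base)
  finally have "tcong LLP (hopf_triple_inv (tgt H b * m, n, q))
      (lin (scale_triple n q) (lin (scale_triple (src H b) 1) (lin double_coact (\<tau> m))))"
    unfolding hopf_triple_inv_def by (simp add: preserves_lin [OF scale_triple_LLP])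
  then show "tcong LLP (hopf_triple_inv (tgt H b * m, n, q)) (hopf_triple_inv (m, src H b * n, q))"
    by (simp add: hopf_triple_inv_def lin_lin scale_triple_scale_triple)
next
  fix b m n q
  have "tcong LLP (lin (scale_triple (tgt H b) 1) (lin double_coact (\<tau> m)))
      (lin (scale_triple 1 (str A b)) (lin double_coact (\<tau> m)))"
    unfolding lin_lin by (auto intro!: tcong_lin double_coact_takeuchi [unfolded lin_lin])
  from preserves_lin [OF scale_triple_LLP [of n q] this]
  show "tcong LLP (hopf_triple_inv (m, tgt H b * n, q)) (hopf_triple_inv (m, n, str A b * q))"
    by (simp add: hopf_triple_inv_def lin_lin scale_triple_scale_triple)
qed (auto simp: hopf_triple_inv_def scale_triple_def LLP_invertible distrib_left
    intro!: tcong_lin_plus intro: LLP_rules [simplified])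

lemma hopf_triple_scale_triple:
  "lin hopf_triple (scale_triple y r t) = lin (scale_triple y r) (hopf_triple t)"
  by (simp add: hopf_triple_def scale_triple_def split_def lin_lin mult.assoc)

lemma hopf_triple_inv_scale_triple:
  "lin hopf_triple_inv (scale_triple 1 r t) = lin (scale_triple 1 r) (hopf_triple_inv t)"
  by (simp add: hopf_triple_inv_def scale_triple_def split_def lin_lin mult.assoc)

text \<open>
  The key identity applied to the translation map, where the Galois map yields \<open>X \<otimes> 1\<close>.
\<close>

lemma hopf_triple_translation:
  "tcong LL_P (lin hopf_triple (lin double_coact (\<tau> X))) {#(X, 1, 1)#}"
proof -
  have "tcong LL_P (lin hopf_triple (lin double_coact (\<tau> X))) (lin coact_right (lin can_sum (\<tau> X)))"
    unfolding lin_lin by (auto intro!: tcong_lin hopf_double_coact)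
  also have "tcong LL_P \<dots> (lin coact_right {#(X, 1)#})"
    using coact_right_preserves can_translation by (rule preserves_lin)
  also have "tcong LL_P \<dots> {#(X, 1, 1)#}"
  proof -
    have "preserves LP LL_P (\<lambda>(y, p'). {#(X, y, p')#})"
      by (rule preserves_LP) (auto simp: LL_P_invertible intro: LL_P_rules [simplified])
    from preserves_lin [OF this rep_coaction_one] show ?thesis by (simp add: coact_right_def)
  qed
  finally show ?thesis .
qed

lemma hopf_triple_surj: "tcong LL_P (lin hopf_triple (hopf_triple_inv t)) {#t#}"
proof -
  obtain x y r where t: "t = (x, y, r)" by (cases t)
  have "lin hopf_triple (hopf_triple_inv t) =
      lin (scale_triple y r) (lin hopf_triple (lin double_coact (\<tau> x)))"
    by (simp add: t hopf_triple_inv_def lin_lin hopf_triple_scale_triple)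
  also have "tcong LL_P \<dots> (lin (scale_triple y r) {#(x, 1, 1)#})"
    using scale_triple_LL_P hopf_triple_translation by (rule preserves_lin)
  finally show ?thesis by (simp add: t scale_triple_def)
qed

text \<open>
  By the key identity the argument is \<open>p\<^sub>-\<^sub>1 \<otimes> (p\<^sub>0 q)\<^sub>-\<^sub>1 \<otimes> (p\<^sub>0 q)\<^sub>0\<close>. The inverse absorbs the coaction: it sends
  \<open>x \<otimes> r\<^sub>-\<^sub>1 \<otimes> r\<^sub>0\<close> to the double coaction of \<open>x' \<otimes> x'' r\<close>. Summed over \<open>x \<otimes> r = p\<^sub>-\<^sub>1 \<otimes> p\<^sub>0 q\<close>, the
  elements \<open>x' \<otimes> x'' r\<close> add up to the preimage of \<open>p\<^sub>-\<^sub>1 \<otimes> p\<^sub>0 q\<close> under the Galois map, which is \<open>p \<otimes> q\<close>.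
\<close>

lemma hopf_triple_inv_double_coact:
  "tcong LLP (lin hopf_triple_inv (lin hopf_triple (double_coact (p, q)))) (double_coact (p, q))"
proof -
  \<comment> \<open>the sum of all \<open>x' \<otimes> x'' r\<close> over \<open>x \<otimes> r = p\<^sub>-\<^sub>1 \<otimes> p\<^sub>0 q\<close>\<close>
  let ?W = "lin (\<lambda>(x, r). lin (\<lambda>(p, q). {#(p, q * r)#}) (\<tau> x)) (can_sum (p, q))"
  have *: "tcong LLP (lin hopf_triple_inv (coact_right (x, r)))
      (lin double_coact (lin (\<lambda>(p, q). {#(p, q * r)#}) (\<tau> x)))" for x r
  proof -
    have "tcong LLP (lin (\<lambda>(y, r'). lin (scale_triple y r') (double_coact (p, q))) (\<kappa> r))
        (double_coact (p, q * r))" for p q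
    proof -
      have "lin (\<lambda>(y, r'). lin (scale_triple y r') (double_coact (p, q))) (\<kappa> r) =
        lin (coact_left p) (mult_sum (\<kappa> q) (\<kappa> r))"
        unfolding mult_sum_swap double_coact_def
        by (simp add: lin_lin coact_left_def scale_triple_def split_def mult.assoc)
      also have "tcong LLP \<dots> (double_coact (p, q * r))"
        using preserves_lin [OF coact_left_preserves tcong.sym [OF rep_coaction_mult]]
        by (simp add: double_coact_def)
      finally show ?thesis .
    qed
    then have "tcong LLP (lin (\<lambda>(p, q). lin (\<lambda>(y, r'). lin (scale_triple y r') (double_coact (p, q))) (\<kappa> r)) (\<tau> x))
       (lin (\<lambda>(p, q). double_coact (p, q * r)) (\<tau> x))"
      by (auto intro!: tcong_lin)
    moreover have "lin (\<lambda>(p, q). lin (\<lambda>(y, r'). lin (scale_triple y r') (double_coact (p, q))) (\<kappa> r)) (\<tau> x)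
        = lin hopf_triple_inv (coact_right (x, r))"
      unfolding coact_right_def hopf_triple_inv_def split_def
      by (subst lin_swap) (simp add: lin_lin)
    ultimately show ?thesis by (simp add: lin_lin split_def)
  qed
  have "tcong LLP (lin hopf_triple_inv (lin hopf_triple (double_coact (p, q))))
      (lin hopf_triple_inv (lin coact_right (can_sum (p, q))))"
    using hopf_triple_inv_preserves hopf_double_coact by (rule preserves_lin)
  also have "tcong LLP \<dots> (lin double_coact ?W)"
    unfolding lin_lin [of hopf_triple_inv] lin_lin [of double_coact] using * by (auto intro!: tcong_lin)
  also have "tcong LLP \<dots> (lin double_coact {#(p, q)#})"
  proof (rule preserves_lin [OF double_coact_preserves can_inject])
    have "tcong LP (lin can_sum ?W) (lin (\<lambda>a. {#a#}) (can_sum (p, q)))"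
      unfolding lin_lin [of can_sum] by (auto intro!: tcong_lin can_translation_mult)
    then show "tcong LP (lin can_sum ?W) (lin can_sum {#(p, q)#})" by (simp add: lin_singletons)
  qed
  finally show ?thesis by simp
qed

text \<open>
  Surjectivity of the Galois map, used twice: first to write \<open>x \<otimes> r\<close> as a sum of \<open>p\<^sub>-\<^sub>1 \<otimes> p\<^sub>0 s\<close>, then \<open>y \<otimes> s\<close>
  as a sum of \<open>u\<^sub>-\<^sub>1 \<otimes> u\<^sub>0 v s\<close>.
\<close>

lemma triple_generated:
  "\<exists>z. tcong LLP {#t#} (lin (\<lambda>(p, q, r). lin (scale_triple 1 r) (double_coact (p, q))) z)"
proof -
  obtain x y r where t: "t = (x, y, r)" by (cases t)
  let ?z = "lin (\<lambda>(p, q). lin (\<lambda>(u, v). {#(p, u, v * (q * r))#}) (\<tau> y)) (\<tau> x)"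
  have *: "preserves LP LLP (\<lambda>(x, r). {#(x, y, r)#})"
    by (rule preserves_LP) (auto simp: LLP_invertible intro: LLP_rules [simplified])
  have "tcong LLP {#t#} (lin (\<lambda>(x, r). {#(x, y, r)#}) (lin can_sum (lin (\<lambda>(p, q). {#(p, q * r)#}) (\<tau> x))))"
    using preserves_lin [OF * tcong.sym [OF can_translation_mult]] by (simp add: t)
  also have "\<dots> = lin (\<lambda>(p, q). coact_left p (y, q * r)) (\<tau> x)"
    by (simp add: lin_lin can_sum_def coact_left_def split_def)
  also have "tcong LLP \<dots> (lin (\<lambda>(p, q). lin (coact_left p)
      (lin can_sum (lin (\<lambda>(u, v). {#(u, v * (q * r))#}) (\<tau> y)))) (\<tau> x))"
    using preserves_lin [OF coact_left_preserves tcong.sym [OF can_translation_mult]]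
    by (auto intro!: tcong_lin)
  also have "\<dots> = lin (\<lambda>(p, q, r). lin (scale_triple 1 r) (double_coact (p, q))) ?z"
    by (simp add: lin_lin can_sum_def coact_left_def double_coact_def scale_triple_def split_def mult.assoc)
  finally show ?thesis by blast
qed

lemma hopf_triple_inv_hopf_triple:
  "tcong LLP (lin hopf_triple_inv (lin hopf_triple z)) z"
proof -
  have "tcong LLP (lin hopf_triple_inv (hopf_triple t)) {#t#}" for t
  proof -
    obtain z where z: "tcong LLP {#t#} (lin (\<lambda>(p, q, r). lin (scale_triple 1 r) (double_coact (p, q))) z)"
      using triple_generated by blast
    from preserves_lin [OF hopf_triple_inv_preserves preserves_lin [OF hopf_triple_preserves this]]
    have "tcong LLP (lin hopf_triple_inv (hopf_triple t)) (lin (\<lambda>(p, q, r). lin (scale_triple 1 r)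
        (lin hopf_triple_inv (lin hopf_triple (double_coact (p, q))))) z)"
      by (simp add: lin_lin split_def hopf_triple_scale_triple hopf_triple_inv_scale_triple)
    also have "tcong LLP \<dots> (lin (\<lambda>(p, q, r). lin (scale_triple 1 r) (double_coact (p, q))) z)"
      by (auto intro!: tcong_lin preserves_lin [OF scale_triple_LLP] hopf_triple_inv_double_coact)
    also note tcong.sym [OF z]
    finally show ?thesis .
  qed
  then have "tcong LLP (lin (\<lambda>t. lin hopf_triple_inv (hopf_triple t)) z) (lin (\<lambda>t. {#t#}) z)"
    by (intro tcong_lin)
  then show ?thesis by (simp add: lin_lin lin_singletons)
qed

lemma hopf_triple_inject:
  assumes "tcong LL_P (lin hopf_triple z) (lin hopf_triple w)"
  shows "tcong LLP z w"
  using preserves_lin [OF hopf_triple_inv_preserves assms] hopf_triple_inv_hopf_triple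
  by (meson tcong.sym tcong.trans)

end

section \<open>Bijectivity of the Hopf map\<close>

context left_galois_extension
begin

interpretation dom: presented_module "LbarL_rel H"
  "\<lambda>z. encode (tclass (LbarL_rel H) z) :: ('b, 'l, 'p) test_universe" "\<lambda>b (X, Y). (tgt H b * X, Y)"
  by (rule LbarL_presented)

interpretation cod: presented_module "LL_rel H"
  "\<lambda>z. encode (tclass (LL_rel H) z) :: ('b, 'l, 'p) test_universe" "\<lambda>b (X, Y). (X, tgt H b * Y)"
  by (rule LL_presented)

abbreviation dom_class :: "('l \<times> 'l) multiset \<Rightarrow> ('b, 'l, 'p) test_universe" where
  "dom_class z \<equiv> encode (tclass (LbarL_rel H) z)"
abbreviation cod_class :: "('l \<times> 'l) multiset \<Rightarrow> ('b, 'l, 'p) test_universe" where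
  "cod_class z \<equiv> encode (tclass (LL_rel H) z)"
abbreviation triple :: "'l \<times> 'l \<Rightarrow> 'p \<Rightarrow> 'l \<times> 'l \<times> 'p" where
  "triple a p \<equiv> (fst a, snd a, p)"
abbreviation strP :: "'b \<Rightarrow> 'p \<Rightarrow> 'p" where
  "strP b p \<equiv> str A b * p"
abbreviation domP where "domP \<equiv> tensor_rel UNIV dom.carried_module (univ_module strP)"
abbreviation codP where "codP \<equiv> tensor_rel UNIV cod.carried_module (univ_module strP)"

text \<open>
  The Hopf map between the copies of its source and codomain in the test universe.
\<close>

definition hopf_carried :: "('b, 'l, 'p) test_universe \<Rightarrow> ('b, 'l, 'p) test_universe" where
  "hopf_carried u = cod_class (lin hopf_sum (dom.pick u))"

lemma hopf_carried_class: "hopf_carried (dom_class z) = cod_class (lin hopf_sum z)"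
  unfolding hopf_carried_def cod.q_iff by (rule preserves_lin [OF hopf_sum_preserves dom.inv_q])

lemma hopf_carried_module_map:
  "hopf_carried \<in> module_maps (ring_of UNIV) dom.carried_module cod.carried_module"
proof -
  have "tcong (LL_rel H) (lin hopf_sum (image_mset (\<lambda>(X, Y). (tgt H b * X, Y)) z))
      (image_mset (\<lambda>(X, Y). (X, tgt H b * Y)) (lin hopf_sum z))" for b z
    unfolding image_lin lin_image
    by (rule tcong_lin) (use hopf_sum_tgt in \<open>auto simp: split_def lin_singletons\<close>)
  then show ?thesis
    by (auto simp: module_maps_def hopf_carried_class cod.q_iff simp del: lin_image)
qed

lemma expand_cod: "preserves codP LL_P (cod.expand triple)"
proof (rule cod.expand_preserves)
  fix p
  show "preserves (LL_rel H) LL_P (\<lambda>a. {#triple a p#})"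
    by (rule preserves_LL) (auto simp: LL_P_invertible intro: LL_P_rules [simplified])
qed (use LL_P_invertible in \<open>auto simp: group_rel_def intro: LL_P_rules [simplified]\<close>)

text \<open>
  Regrouping: a triple \<open>X \<otimes> Y \<otimes> p\<close> is the class of \<open>X \<otimes> Y\<close> tensored with \<open>p\<close>. The relation between the first and
  last factor is the balancedness over \<open>B\<close> of that tensor product.
\<close>

lemma collect_dom: "preserves LLP domP (\<lambda>(X, Y, p). {#dom.collect (X, Y) p#})"
proof (rule preserves_LLP)
  note rules = dom.tensor_P_rules [where sP = strP]
  have add: "tcong domP {#(dom_class {#a#}, p)#} ({#(dom_class {#b#}, p)#} + {#(dom_class {#c#}, p)#})"
    if "tcong (LbarL_rel H) {#a#} ({#b#} + {#c#})" for a b c p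
  proof -
    have "dom_class {#a#} = dom_class ({#b#} + {#c#})" using that unfolding dom.q_iff .
    then show ?thesis using rules(1) [of "{#b#}" "{#c#}" p] by simp
  qed
  {
    fix m m' n p
    show "tcong domP (case (m + m', n, p) of (X, Y, p) \<Rightarrow> {#dom.collect (X, Y) p#})
       ((case (m, n, p) of (X, Y, p) \<Rightarrow> {#dom.collect (X, Y) p#}) + (case (m', n, p) of (X, Y, p) \<Rightarrow> {#dom.collect (X, Y) p#}))"
      unfolding dom.collect_def prod.case by (rule add, rule LbarL_rules)
  next
    fix m n n' p
    show "tcong domP (case (m, n + n', p) of (X, Y, p) \<Rightarrow> {#dom.collect (X, Y) p#})
       ((case (m, n, p) of (X, Y, p) \<Rightarrow> {#dom.collect (X, Y) p#}) + (case (m, n', p) of (X, Y, p) \<Rightarrow> {#dom.collect (X, Y) p#}))"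
      unfolding dom.collect_def prod.case by (rule add, rule LbarL_rules)
  next
    fix b m n p
    have "dom_class {#(m * tgt H b, n)#} = dom_class {#(m, tgt H b * n)#}"
      unfolding dom.q_iff by (rule LbarL_rules)
    then show "tcong domP (case (m * tgt H b, n, p) of (X, Y, p) \<Rightarrow> {#dom.collect (X, Y) p#})
       (case (m, tgt H b * n, p) of (X, Y, p) \<Rightarrow> {#dom.collect (X, Y) p#})"
      by (simp add: dom.collect_def tcong.refl)
  next
    fix b m n p
    show "tcong domP (case (tgt H b * m, n, p) of (X, Y, p) \<Rightarrow> {#dom.collect (X, Y) p#})
       (case (m, n, str A b * p) of (X, Y, p) \<Rightarrow> {#dom.collect (X, Y) p#})"
      using rules(5) [of b "{#(m, n)#}" p] by (simp add: dom.collect_def)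
  next
    fix m n p p'
    show "tcong domP (case (m, n, p + p') of (X, Y, p) \<Rightarrow> {#dom.collect (X, Y) p#})
       ((case (m, n, p) of (X, Y, p) \<Rightarrow> {#dom.collect (X, Y) p#}) + (case (m, n, p') of (X, Y, p) \<Rightarrow> {#dom.collect (X, Y) p#}))"
      using rules(2) [of "{#(m, n)#}" p p'] by (simp add: dom.collect_def)
  next
    fix m n p
    show "invertible_in domP (case (m, n, p) of (X, Y, p) \<Rightarrow> {#dom.collect (X, Y) p#})"
      unfolding dom.collect_def prod.case by (rule dom.tensor_P_invertible)
  }
qed

text \<open>
  The analogous regrouping of \<open>\<L> \<diamondop> \<L> \<diamondop> P\<close>, where \<open>B\<close> acts on the second factor.
\<close>

lemma collect_cod: "preserves LL_P codP (\<lambda>(X, Y, p). {#cod.collect (X, Y) p#})"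
proof (rule preserves_LL_P)
  note rules = cod.tensor_P_rules [where sP = strP]
  have add: "tcong codP {#(cod_class {#a#}, p)#} ({#(cod_class {#b#}, p)#} + {#(cod_class {#c#}, p)#})"
    if "tcong (LL_rel H) {#a#} ({#b#} + {#c#})" for a b c p
  proof -
    have "cod_class {#a#} = cod_class ({#b#} + {#c#})" using that unfolding cod.q_iff .
    then show ?thesis using rules(1) [of "{#b#}" "{#c#}" p] by simp
  qed
  {
    fix m m' n p
    show "tcong codP (case (m + m', n, p) of (X, Y, p) \<Rightarrow> {#cod.collect (X, Y) p#})
       ((case (m, n, p) of (X, Y, p) \<Rightarrow> {#cod.collect (X, Y) p#}) + (case (m', n, p) of (X, Y, p) \<Rightarrow> {#cod.collect (X, Y) p#}))"
      unfolding cod.collect_def prod.case by (rule add, rule LL_rules)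
  next
    fix m n n' p
    show "tcong codP (case (m, n + n', p) of (X, Y, p) \<Rightarrow> {#cod.collect (X, Y) p#})
       ((case (m, n, p) of (X, Y, p) \<Rightarrow> {#cod.collect (X, Y) p#}) + (case (m, n', p) of (X, Y, p) \<Rightarrow> {#cod.collect (X, Y) p#}))"
      unfolding cod.collect_def prod.case by (rule add, rule LL_rules)
  next
    fix b m n p
    have "cod_class {#(tgt H b * m, n)#} = cod_class {#(m, src H b * n)#}"
      unfolding cod.q_iff by (rule LL_rules)
    then show "tcong codP (case (tgt H b * m, n, p) of (X, Y, p) \<Rightarrow> {#cod.collect (X, Y) p#})
       (case (m, src H b * n, p) of (X, Y, p) \<Rightarrow> {#cod.collect (X, Y) p#})"
      by (simp add: cod.collect_def tcong.refl)
  next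
    fix b m n p
    show "tcong codP (case (m, tgt H b * n, p) of (X, Y, p) \<Rightarrow> {#cod.collect (X, Y) p#})
       (case (m, n, str A b * p) of (X, Y, p) \<Rightarrow> {#cod.collect (X, Y) p#})"
      using rules(5) [of b "{#(m, n)#}" p] by (simp add: cod.collect_def)
  next
    fix m n p p'
    show "tcong codP (case (m, n, p + p') of (X, Y, p) \<Rightarrow> {#cod.collect (X, Y) p#})
       ((case (m, n, p) of (X, Y, p) \<Rightarrow> {#cod.collect (X, Y) p#}) + (case (m, n, p') of (X, Y, p) \<Rightarrow> {#cod.collect (X, Y) p#}))"
      using rules(2) [of "{#(m, n)#}" p p'] by (simp add: cod.collect_def)
  next
    fix m n p
    show "invertible_in codP (case (m, n, p) of (X, Y, p) \<Rightarrow> {#cod.collect (X, Y) p#})"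
      unfolding cod.collect_def prod.case by (rule cod.tensor_P_invertible)
  }
qed

lemma hopf_triple_hopf_sum: "hopf_triple (X, Y, p) = image_mset (\<lambda>a. triple a p) (hopf_sum (X, Y))"
  by (simp add: hopf_triple_def hopf_sum_def image_lin split_def)

text \<open>
  After regrouping, the Hopf map tensored with \<open>P\<close> is \<open>\<Lambda>\<close>.
\<close>

lemma expand_hopf:
  "tcong LL_P (cod.expand triple (hopf_carried y, p)) (lin hopf_triple (dom.expand triple (y, p)))"
proof -
  have "preserves (LL_rel H) LL_P (\<lambda>a. {#triple a p#})"
    by (rule preserves_LL) (auto simp: LL_P_invertible intro: LL_P_rules [simplified])
  from preserves_image [OF this cod.inv_q [of "lin hopf_sum (dom.pick y)"]]
  show ?thesis
    by (simp add: cod.expand_def dom.expand_def hopf_carried_def image_lin hopf_triple_hopf_sum)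
qed

lemma collect_expand_dom:
  "lin (\<lambda>(X, Y, p). {#dom.collect (X, Y) p#}) (lin (dom.expand triple) z) = lin (dom.expand dom.collect) z"
  by (simp add: lin_lin image_lin dom.expand_def split_def lin_singletons multiset.map_comp comp_def)

lemma collect_expand_cod:
  "lin (\<lambda>(X, Y, p). {#cod.collect (X, Y) p#}) (lin (cod.expand triple) z) = lin (cod.expand cod.collect) z"
  by (simp add: lin_lin image_lin cod.expand_def split_def lin_singletons multiset.map_comp comp_def)

context
  assumes flat: "faithfully_flat TYPE(('b, 'l, 'p) test_universe) (ring_of UNIV) (univ_module strP)"
begin

interpretation test: faithfully_flat_test "ring_of UNIV" "univ_module strP" dom.carried_module cod.carried_module hopf_carried
  by (rule faithfully_flat_test.intro [OF flat dom.right_module cod.right_module hopf_carried_module_map])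

lemma hopf_carried_inj: "inj_on hopf_carried (range dom_class)"
proof -
  have "tcong domP z {#}" if z: "set_mset z \<subseteq> range dom_class \<times> UNIV"
    and k: "tcong codP (image_mset (\<lambda>(y, m). (hopf_carried y, m)) z) {#}" for z
  proof -
    have "tcong LL_P (lin hopf_triple (lin (dom.expand triple) z))
        (lin (cod.expand triple) (image_mset (\<lambda>(y, m). (hopf_carried y, m)) z))"
      unfolding lin_lin lin_image by (rule tcong_lin) (auto intro: tcong.sym [OF expand_hopf])
    also have "tcong LL_P \<dots> (lin (cod.expand triple) {#})"
      using expand_cod k by (rule preserves_lin)
    finally have "tcong LLP (lin (dom.expand triple) z) {#}"
      by (intro hopf_triple_inject) simp
    from preserves_lin [OF collect_dom this]
    have "tcong domP (lin (dom.expand dom.collect) z) {#}"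
      by (simp add: collect_expand_dom)
    then show ?thesis
      using dom.expand_collect [OF z] tcong.trans tcong.sym by blast
  qed
  from test.inj_onI_tensor [unfolded ring_of_simps univ_module_simps dom.carried_module_simps, OF this]
  show ?thesis by simp
qed

lemma hopf_carried_surj: "hopf_carried ` range dom_class = range cod_class"
proof -
  have "\<exists>w. set_mset w \<subseteq> range dom_class \<times> UNIV \<and>
      tcong codP (image_mset (\<lambda>(y, m). (hopf_carried y, m)) w) z"
    if z: "set_mset z \<subseteq> range cod_class \<times> UNIV" for z
  proof -
    let ?c = "\<lambda>(X, Y, p). {#cod.collect (X, Y) p#} :: (('b, 'l, 'p) test_universe \<times> 'p) multiset"
    \<comment> \<open>expand, apply the inverse of \<open>\<Lambda>\<close>, and regroup\<close>
    define v where "v = lin (cod.expand triple) z"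
    define w' where "w' = lin hopf_triple_inv v"
    define w where "w = image_mset (\<lambda>(X, Y, p). dom.collect (X, Y) p) w'"
    have "tcong LL_P (lin hopf_triple w') (lin (\<lambda>t. {#t#}) v)"
      unfolding w'_def lin_lin by (intro tcong_lin hopf_triple_surj)
    then have w': "tcong LL_P (lin hopf_triple w') v" by (simp add: lin_singletons)
    have "tcong codP (image_mset (\<lambda>(y, m). (hopf_carried y, m)) w) (lin ?c (lin hopf_triple w'))"
    proof -
      have "tcong codP {#(hopf_carried (dom_class {#(X, Y)#}), p)#} (lin ?c (hopf_triple (X, Y, p)))" for X Y p
        using tcong.sym [OF cod.collect_sum [of strP p "hopf_sum (X, Y)"]]
        by (simp add: hopf_carried_class hopf_triple_hopf_sum lin_singletons)
      then have "tcong codP (lin (\<lambda>(X, Y, p). {#(hopf_carried (dom_class {#(X, Y)#}), p)#}) w') (lin ?c (lin hopf_triple w'))"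
        unfolding lin_lin by (intro tcong_lin) auto
      then show ?thesis
        by (simp add: w_def dom.collect_def split_def lin_singletons multiset.map_comp comp_def)
    qed
    also have "tcong codP \<dots> (lin ?c v)" using collect_cod w' by (rule preserves_lin)
    also have "tcong codP \<dots> z"
      unfolding v_def collect_expand_cod by (rule cod.expand_collect [OF z])
    finally have "tcong codP (image_mset (\<lambda>(y, m). (hopf_carried y, m)) w) z" .
    moreover have "set_mset w \<subseteq> range dom_class \<times> UNIV"
      by (auto simp: w_def dom.collect_def)
    ultimately show ?thesis by blast
  qed
  from test.surjI_tensor [unfolded ring_of_simps univ_module_simps dom.carried_module_simps cod.carried_module_simps, OF this]
  show ?thesis by simp
qed

lemma hopf_map_bij: "bij_betw (hopf_map H) (quot (LbarL_rel H)) (quot (LL_rel H))"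
proof -
  have enc: "encode (hopf_map H (tclass (LbarL_rel H) z)) = hopf_carried (dom_class z)" for z
    by (simp add: hopf_map_tclass hopf_carried_class)
  have "inj_on (hopf_map H) (quot (LbarL_rel H))"
  proof (rule inj_onI)
    fix C D assume CD: "C \<in> quot (LbarL_rel H)" "D \<in> quot (LbarL_rel H)" "hopf_map H C = hopf_map H D"
    obtain z w where zw: "C = tclass (LbarL_rel H) z" "D = tclass (LbarL_rel H) w"
      using CD(1,2) unfolding quot_def by blast
    then have "hopf_carried (dom_class z) = hopf_carried (dom_class w)"
      using CD(3) by (simp add: enc [symmetric])
    then have "dom_class z = dom_class w" by (rule inj_onD [OF hopf_carried_inj]) auto
    then show "C = D" using injD [OF inj_encode] zw by blast
  qed
  moreover have "hopf_map H ` quot (LbarL_rel H) = quot (LL_rel H)"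
  proof
    show "hopf_map H ` quot (LbarL_rel H) \<subseteq> quot (LL_rel H)"
      by (auto simp: quot_def hopf_map_tclass)
    show "quot (LL_rel H) \<subseteq> hopf_map H ` quot (LbarL_rel H)"
    proof
      fix C assume "C \<in> quot (LL_rel H)"
      then obtain z where z: "C = tclass (LL_rel H) z" by (auto simp: quot_def)
      have "cod_class z \<in> hopf_carried ` range dom_class" by (simp add: hopf_carried_surj)
      then obtain w where "cod_class z = encode (hopf_map H (tclass (LbarL_rel H) w))"
        by (auto simp: enc)
      then have "C = hopf_map H (tclass (LbarL_rel H) w)" using injD [OF inj_encode] z by blast
      then show "C \<in> hopf_map H ` quot (LbarL_rel H)" by (auto simp: quot_def)
    qed
  qed
  ultimately show ?thesis by (simp add: bij_betw_def)
qed

text \<open>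
  Both sides are mapped to \<open>X \<otimes> 1 \<otimes> 1\<close> by the injective map \<open>\<Lambda>\<close>.
\<close>

lemma plus_minus_formula:
  "tcong LLP (image_mset (\<lambda>(Y, Z). (Y, Z, 1)) (rep (plus_minus H X))) (lin double_coact (\<tau> X))"
proof (rule hopf_triple_inject)
  let ?z = "rep (plus_minus H X)"
  have "tclass (LL_rel H) {#(X, 1)#} \<in> hopf_map H ` quot (LbarL_rel H)"
    using hopf_map_bij by (simp add: bij_betw_def quot_def)
  then have "plus_minus H X \<in> quot (LbarL_rel H)" "hopf_map H (plus_minus H X) = tclass (LL_rel H) {#(X, 1)#}"
    by (simp_all add: plus_minus_def inv_into_into f_inv_into_f)
  then have "tcong (LL_rel H) (lin hopf_sum ?z) {#(X, 1)#}"
    using hopf_map_tclass [of ?z] by (simp add: tclass_rep tclass_eq_iff tcong.sym)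
  from preserves_lin [OF LL_to_LL_P [of 1 1] this]
  have "tcong LL_P (lin hopf_triple (image_mset (\<lambda>(Y, Z). (Y, Z, 1)) ?z)) {#(X, 1, 1)#}"
    by (simp add: lin_lin hopf_sum_def hopf_triple_def split_def)
  also note tcong.sym [OF hopf_triple_translation]
  finally show "tcong LL_P (lin hopf_triple (image_mset (\<lambda>(Y, Z). (Y, Z, 1)) ?z))
      (lin hopf_triple (lin double_coact (\<tau> X)))" .
qed

end

end

theorem lemma3p12:
  fixes H :: "('k::field, 'b::{ring,monoid_mult}, 'l::{ring,monoid_mult}) bialgebroid"
    and A :: "('k, 'b, 'l, 'p::{ring,monoid_mult}) coacted_ring"
  assumes "left_bialgebroid H"
    and "total_faithfully_flat TYPE(('b, 'l, 'p) test_universe) H"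
    and "ring_faithfully_flat TYPE(('b, 'l, 'p) test_universe) A"
    and "faithfully_flat_galois TYPE(('b, 'l, 'p) test_universe) H A"
  shows "left_hopf_algebroid H \<and>
    (\<forall>X. tclass (LLP_rel H A)
           (image_mset (\<lambda>(Y, Z). (Y, Z, 1)) (rep (plus_minus H X))) =
         tclass (LLP_rel H A)
           (\<Sum>(p, q)\<in>#rep (translation H A X).
              \<Sum>(Y, p')\<in>#rep (coaction A p).
                image_mset (\<lambda>(Z, q'). (Y, Z, p' * q')) (rep (coaction A q))))"
proof -
  interpret left_galois_extension H A
    using assms(4) by (simp add: faithfully_flat_galois_def left_galois_def
        left_galois_extension_def left_galois_extension_axioms_def)
  have flat: "faithfully_flat TYPE(('b, 'l, 'p) test_universe) (ring_of UNIV)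
      (univ_module (\<lambda>b p. str A b * p))"
    using assms(3) by (simp add: ring_faithfully_flat_def)
  have "left_hopf_algebroid H"
    using assms(1) hopf_map_bij [OF flat] by (simp add: left_hopf_algebroid_def)
  moreover have "(\<Sum>(p, q)\<in>#\<tau> X. \<Sum>(Y, p')\<in>#\<kappa> p. image_mset (\<lambda>(Z, q'). (Y, Z, p' * q')) (\<kappa> q)) =
      lin double_coact (\<tau> X)" for X
    unfolding lin_def [of double_coact]
    by (rule arg_cong [where f = sum_mset], rule image_mset_cong)
      (auto simp: double_coact_alt lin_def [symmetric] lin_singletons split_def)
  ultimately show ?thesis
    using plus_minus_formula [OF flat] by (simp add: tclass_eq_iff)
qed

end
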